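(* Assume $\mathfrak{b}=\mathfrak{c}$. Let $1<\xi\leq\omega_1$ and let $(p_n)_{n<\omega}$ be a Rudin--Keisler-increasing sequence (that is, $p_{n+1}>_{RK}p_n$ for each $n$) of elements of $\mathcal{P}_\xi$. Then there exists $u\in\mathcal{P}_\xi$ such that $u>_{RK}p_n$ for each $n<\omega$.
   Context: All filters are on $\omega$. $\mathfrak{b}$ is the bounding number and $\mathfrak{c}=2^{\aleph_0}$. For ultrafilters $u,v$ on $\omega$, $u\geq_{RK}v$ means that there is $f:\omega\to\omega$ with $f(u)=v$, where $f(u)=\{A\subset\omega: f^{-1}[A]\in u\}$; $u>_{RK}v$ means $u\geq_{RK}v$ and not $v\geq_{RK}u$. Cascades. A cascade is a tree $V$ (a partially ordered set with least element $\emptyset_V$ in which the predecessors of each element form a finite chain) without infinite branches. $\max V$ is the set of its maximal elements, and $v^{+}$ is the set of immediate successors of $v$. The cascade is sequential if $v^{+}$ is countably infinite for every $v\in V\setminus\max V$. The rank is defined inductively: $r(v)=0$ if $v\in\max V$, and otherwise $r(v)$ is the least ordinal greater than the ranks of all immediate successors of $v$; $r(V)=r(\emptyset_V)$. A sequential cascade $V$ is monotone if each $v^{+}$ ($v\in V\setminus\max V$) can be ordered in type $\omega$ so that the ranks of its successive elements form a non-decreasing sequence. Contours. Consider sequential cascades with $r(V)\geq1$ and $\max V\subset\omega$. The contour $\int V$ is defined inductively: if $r(V)=1$, it is the cofinite filter on $\max V$; if $r(V)>1$, a set $A$ belongs to $\int V$ iff, for all but finitely many $v\in\emptyset_V^{+}$,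 $A$ belongs to $\int v^{\uparrow}$, where $v^\uparrow=\{w\in V: w\geq v\}$ with the inherited order (and, if $v\in\max V$, this means $v\in A$). The contour is regarded as a filter on $\omega$ by closing under supersets in $\omega$. A monotone sequential contour of rank $\beta$ is a filter $\int V$ where $V$ is a monotone sequential cascade of rank $\beta$; such ranks are countable ordinals $\beta\geq 1$. P-hierarchy. For an ordinal $1\leq\alpha\leq\omega_1$, an ultrafilter $u$ on $\omega$ belongs to the class $\mathcal{P}_\alpha$ if (1) for each $1\leq\beta<\alpha$ there is a monotone sequential contour of rank $\beta$ contained in $u$, and (2) there is no monotone sequential contour of rank $\alpha$ contained in $u$. *)

theory Defs
  imports Main "HOL-Library.Countable_Set_Type"
begin

unbundle cardinal_syntax

section \<open>Ordinals\<close>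

text \<open>
  Order types of well-orders on sets of sets of natural numbers, that is, all ordinals of
  cardinality at most continuum.  These include \<open>\<omega>\<^sub>1\<close> and, by \<open>rank_less_omega1\<close> below, all
  ranks of nodes of sequential cascades.
\<close>

lemma ordIso_self_iff: "r =o r \<longleftrightarrow> Well_order r"
  using ordIso_reflexive by (auto simp: ordIso_def)

lemma Well_order_small: "Well_order {}" "Well_order {(x, x)}"
  by (simp_all add: well_order_on_def linear_order_on_def partial_order_on_def
      preorder_on_def refl_on_def trans_def antisym_def total_on_def)

quotient_type ordinal = "nat set rel" / partial: "\<lambda>r s. r =o s"
  morphisms rep_ordinal order_type
proof (rule part_equivpI)
  have "({} :: nat set rel) =o ({} :: nat set rel)"
    unfolding ordIso_self_iff by (rule Well_order_small)
  then show "\<exists>x::nat set rel. x =o x" by blast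
  show "symp (\<lambda>r s :: nat set rel. r =o s)"
    by (rule sympI) (rule ordIso_symmetric)
  show "transp (\<lambda>r s :: nat set rel. r =o s)"
    by (rule transpI) (rule ordIso_transitive)
qed

instantiation ordinal :: "{zero, one, ord}"
begin

lift_definition zero_ordinal :: ordinal is "{}"
  unfolding ordIso_self_iff by (rule Well_order_small)

lift_definition one_ordinal :: ordinal is "{({}, {})}"
  unfolding ordIso_self_iff by (rule Well_order_small)

lift_definition less_eq_ordinal :: "ordinal \<Rightarrow> ordinal \<Rightarrow> bool" is "\<lambda>r s. r \<le>o s"
  by (meson ordIso_ordLeq_trans ordLeq_ordIso_trans ordIso_symmetric)

lift_definition less_ordinal :: "ordinal \<Rightarrow> ordinal \<Rightarrow> bool" is "\<lambda>r s. r <o s"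
  by (meson ordIso_ordLess_trans ordLess_ordIso_trans ordIso_symmetric)

instance ..

end

lift_definition omega1 :: ordinal  (\<open>\<omega>\<^sub>1\<close>) is "cardSuc natLeq"
  using cardSuc_Card_order[OF natLeq_Card_order]
  by (simp add: ordIso_self_iff card_order_on_well_order_on)

lemma ordinal_cases:
  obtains r where "Well_order r" "a = order_type r"
proof
  show "Well_order (rep_ordinal a)"
    using Quotient3_rep_reflp[OF Quotient3_ordinal, of a] by (simp only: ordIso_self_iff)
  show "a = order_type (rep_ordinal a)"
    by (rule Quotient3_abs_rep[OF Quotient3_ordinal, symmetric])
qed

lemma order_type_less_iff:
  "Well_order r \<Longrightarrow> Well_order s \<Longrightarrow> order_type r < order_type s \<longleftrightarrow> r <o s"
  by (simp add: less_ordinal.abs_eq ordIso_self_iff)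

lemma order_type_le_iff:
  "Well_order r \<Longrightarrow> Well_order s \<Longrightarrow> order_type r \<le> order_type s \<longleftrightarrow> r \<le>o s"
  by (simp add: less_eq_ordinal.abs_eq ordIso_self_iff)

lemma order_type_eq_iff:
  "Well_order r \<Longrightarrow> Well_order s \<Longrightarrow> order_type r = order_type s \<longleftrightarrow> r =o s"
  using Quotient3_rel[OF Quotient3_ordinal, of r s] by (simp only: ordIso_self_iff simp_thms)

instance ordinal :: wellorder
proof
  fix a b c :: ordinal
  obtain r where r: "Well_order r" "a = order_type r" by (rule ordinal_cases)
  obtain s where s: "Well_order s" "b = order_type s" by (rule ordinal_cases)
  obtain t where t: "Well_order t" "c = order_type t" by (rule ordinal_cases)
  note w = r(1) s(1) t(1)
  note abc = r(2) s(2) t(2)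
  show "a < b \<longleftrightarrow> a \<le> b \<and> \<not> b \<le> a"
    unfolding abc order_type_less_iff[OF w(1,2)] order_type_le_iff[OF w(1,2)]
      order_type_le_iff[OF w(2,1)] not_ordLeq_iff_ordLess[OF w(1,2)]
    using ordLess_imp_ordLeq by blast
  show "a \<le> a"
    unfolding abc order_type_le_iff[OF w(1,1)] by (rule ordLeq_reflexive[OF w(1)])
  show "a \<le> b \<Longrightarrow> b \<le> c \<Longrightarrow> a \<le> c"
    unfolding abc order_type_le_iff[OF w(1,2)] order_type_le_iff[OF w(2,3)]
      order_type_le_iff[OF w(1,3)]
    by (rule ordLeq_transitive)
  show "a \<le> b \<Longrightarrow> b \<le> a \<Longrightarrow> a = b"
    unfolding abc order_type_le_iff[OF w(1,2)] order_type_le_iff[OF w(2,1)]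
      order_type_eq_iff[OF w(1,2)]
    by (simp only: ordIso_iff_ordLeq simp_thms)
  show "a \<le> b \<or> b \<le> a"
    unfolding abc order_type_le_iff[OF w(1,2)] order_type_le_iff[OF w(2,1)]
    by (rule ordLeq_total[OF w(1,2)])
next
  fix P :: "ordinal \<Rightarrow> bool" and a
  assume step: "\<And>x. (\<And>y. y < x \<Longrightarrow> P y) \<Longrightarrow> P x"
  have *: "Well_order r \<longrightarrow> P (order_type r)" for r
  proof (induction r rule: wf_induct[OF wf_ordLess])
    case (1 r)
    show ?case
    proof (rule impI, rule step)
      fix y assume r: "Well_order r" and y: "y < order_type r"
      obtain s where s: "Well_order s" "y = order_type s" by (rule ordinal_cases)
      then have "s <o r" using y r by (simp add: order_type_less_iff)
      then show "P y" using 1 s by blast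
    qed
  qed
  obtain r where "Well_order r" "a = order_type r" by (rule ordinal_cases)
  with *[of r] show "P a" by (simp only: simp_thms)
qed

lemma zero_ordinal_le [simp]: "(0::ordinal) \<le> a"
proof -
  obtain r where "Well_order r" "a = order_type r" by (rule ordinal_cases)
  then show ?thesis
    unfolding zero_ordinal_def
    by (simp only: order_type_le_iff[OF Well_order_small(1)])
      (simp add: ordLeq_def embed_def Well_order_small)
qed

lemma less_one_ordinal_iff: "a < (1::ordinal) \<longleftrightarrow> a = 0"
proof -
  obtain r where r: "Well_order r" "a = order_type r" by (rule ordinal_cases)
  let ?s = "{({}, {})} :: nat set rel"
  have "Restr ?s (underS ?s {}) = {}" and "Field ?s = {{}}"
    by (auto simp: underS_def)
  then have "r <o ?s \<longleftrightarrow> r =o ({} :: nat set rel)"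
    by (simp only: ordLess_iff_ordIso_Restr[OF Well_order_small(2) r(1)] bex_simps simp_thms)
  then show ?thesis
    unfolding r(2) zero_ordinal_def one_ordinal_def
    by (simp only: order_type_less_iff[OF r(1) Well_order_small(2)]
        order_type_eq_iff[OF r(1) Well_order_small(1)])
qed

lemma countable_bounded_below_omega1:
  assumes "countable A" and "\<forall>a\<in>A. a < \<omega>\<^sub>1"
  shows "\<exists>b<\<omega>\<^sub>1. \<forall>a\<in>A. a < b"
proof -
  define w where "w = cardSuc natLeq"
  have wC: "Card_order w" unfolding w_def by (rule cardSuc_Card_order[OF natLeq_Card_order])
  then have wW: "Well_order w" by (rule card_order_on_well_order_on)
  have om: "\<omega>\<^sub>1 = order_type w" by (simp add: omega1_def w_def)
  have inf: "infinite (Field w)"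
    by (simp only: w_def cardSuc_finite[OF natLeq_Card_order] Field_natLeq) simp
  define S where "S x = Restr w (underS w x)" for x
  have SW: "Well_order (S x)" for x unfolding S_def by (rule Well_order_Restr[OF wW])
  have Sless: "order_type (S x) < \<omega>\<^sub>1" if "x \<in> Field w" for x
    unfolding om order_type_less_iff[OF SW wW]
    using underS_Restr_ordLess[OF wW] that by (auto simp: S_def)
  have "\<exists>x\<in>Field w. a = order_type (S x)" if "a \<in> A" for a
  proof -
    obtain r where r: "Well_order r" "a = order_type r" by (rule ordinal_cases)
    have "r <o w" using assms(2) that r(2) om order_type_less_iff[OF r(1) wW] by auto
    then show ?thesis
      using ordLess_iff_ordIso_Restr[OF wW r(1)]
      unfolding r(2) order_type_eq_iff[OF r(1) SW] by (simp add: S_def)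
  qed
  then have "\<forall>a\<in>A. \<exists>x. x \<in> Field w \<and> a = order_type (S x)" by blast
  then obtain x where "\<forall>a\<in>A. x a \<in> Field w \<and> a = order_type (S (x a))"
    by (rule bchoice[THEN exE])
  then have x: "x a \<in> Field w" "a = order_type (S (x a))" if "a \<in> A" for a
    using that by simp_all
  have "countable (x ` A)" using assms(1) by simp
  then have "|x ` A| \<le>o natLeq" by (simp add: countable_card_le_natLeq)
  then have "\<not> |x ` A| =o w"
    using cardSuc_greater[OF natLeq_Card_order] unfolding w_def
    by (meson not_ordLess_ordIso ordLeq_ordLess_trans)
  moreover have "regularCard w"
    unfolding w_def
    by (rule infinite_cardSuc_regularCard[OF _ natLeq_Card_order]) (simp add: Field_natLeq)
  moreover have "x ` A \<subseteq> Field w" using x(1) by (rule image_subsetI)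
  ultimately have "\<not> cofinal (x ` A) w"
    unfolding regularCard_def by blast
  then obtain y where y: "y \<in> Field w" "\<forall>a\<in>A. y = x a \<or> (y, x a) \<notin> w"
    unfolding cofinal_def by blast
  obtain z where z: "z \<in> Field w" "y \<noteq> z" "(y, z) \<in> w"
    using infinite_Card_order_limit[OF wC inf y(1)] by blast
  have "a < order_type (S z)" if a: "a \<in> A" for a
  proof -
    have wr: "wo_rel w" using wW by (simp add: wo_rel_def)
    have "(x a, y) \<in> w"
      using y(1) bspec[OF y(2) a] x(1)[OF a] wo_rel.TOTALS[OF wr] refl_onD[OF wo_rel.REFL[OF wr]]
      by blast
    then have "(x a, z) \<in> w" "x a \<noteq> z"
      using z wo_rel.TRANS[OF wr] wo_rel.ANTISYM[OF wr] unfolding trans_def antisym_def by blast+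
    then have "underS w (x a) \<subset> underS w z"
      using wo_rel.TRANS[OF wr] wo_rel.ANTISYM[OF wr]
      unfolding underS_def trans_def antisym_def by blast
    then have "S (x a) <o S z"
      unfolding S_def
      using ofilter_subset_ordLess[OF wW] wo_rel.underS_ofilter[OF wr] by blast
    then have "order_type (S (x a)) < order_type (S z)"
      by (simp only: order_type_less_iff[OF SW SW])
    with x(2)[OF a] show ?thesis by (rule ord_eq_less_trans)
  qed
  then have "\<forall>a\<in>A. a < order_type (S z)" by (rule ballI)
  with Sless[OF z(1)] have "order_type (S z) < \<omega>\<^sub>1 \<and> (\<forall>a\<in>A. a < order_type (S z))"
    by (rule conjI)
  then show ?thesis by (rule exI)
qed


section \<open>Ultrafilters, the Rudin--Keisler order and the bounding number\<close>

definition ultrafilter :: "'a filter \<Rightarrow> bool" where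
  "ultrafilter u \<longleftrightarrow> u \<noteq> bot \<and> (\<forall>P. eventually P u \<or> eventually (\<lambda>x. \<not> P x) u)"

definition rk_ge :: "nat filter \<Rightarrow> nat filter \<Rightarrow> bool"  (infix \<open>\<ge>RK\<close> 50) where
  "u \<ge>RK v \<longleftrightarrow> (\<exists>f::nat \<Rightarrow> nat. filtermap f u = v)"

definition rk_greater :: "nat filter \<Rightarrow> nat filter \<Rightarrow> bool"  (infix \<open>>RK\<close> 50) where
  "u >RK v \<longleftrightarrow> u \<ge>RK v \<and> \<not> v \<ge>RK u"

text \<open>Unboundedness with respect to eventual domination.\<close>

definition unbounded_family :: "(nat \<Rightarrow> nat) set \<Rightarrow> bool" where
  "unbounded_family B \<longleftrightarrow> \<not> (\<exists>g. \<forall>f\<in>B. \<forall>\<^sub>F n in sequentially. f n \<le> g n)"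

definition bounding_number :: "(nat \<Rightarrow> nat) rel"  (\<open>\<bb>\<close>) where
  "\<bb> = (SOME \<kappa>. (\<exists>B. unbounded_family B \<and> \<kappa> = |B| ) \<and>
    (\<forall>B. unbounded_family B \<longrightarrow> \<kappa> \<le>o |B| ))"

abbreviation continuum :: "nat set rel"  (\<open>\<cc>\<close>) where
  "\<cc> \<equiv> |UNIV :: nat set set|"

lemma unbounded_family_UNIV: "unbounded_family UNIV"
  unfolding unbounded_family_def
proof (rule notI, elim exE)
  fix g :: "nat \<Rightarrow> nat"
  assume "\<forall>f\<in>UNIV. \<forall>\<^sub>F n in sequentially. f n \<le> g n"
  from bspec[OF this UNIV_I, of "\<lambda>n. Suc (g n)"] show False
    by simp
qed

lemma bounding_number_props:
  "(\<exists>B. unbounded_family B \<and> \<bb> = |B| ) \<and> (\<forall>B. unbounded_family B \<longrightarrow> \<bb> \<le>o |B| )"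
proof -
  have "\<exists>\<kappa> \<in> card_of ` Collect unbounded_family.
      \<forall>r \<in> card_of ` Collect unbounded_family. \<kappa> \<le>o r"
    by (rule exists_minim_Card_order) (use unbounded_family_UNIV card_of_Card_order in blast)+
  then have "\<exists>\<kappa>. (\<exists>B. unbounded_family B \<and> \<kappa> = |B| ) \<and> (\<forall>B. unbounded_family B \<longrightarrow> \<kappa> \<le>o |B| )"
    by blast
  then show ?thesis
    unfolding bounding_number_def by (rule someI_ex)
qed


section \<open>Cascades\<close>

text \<open>A cascade is represented by its reflexive order relation; its set of elements is the field.\<close>

definition is_root :: "'a rel \<Rightarrow> 'a \<Rightarrow> bool" where
  "is_root V v \<longleftrightarrow> v \<in> Field V \<and> (\<forall>w\<in>Field V. (v, w) \<in> V)"

definition root :: "'a rel \<Rightarrow> 'a" where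
  "root V = (THE v. is_root V v)"

definition maxima :: "'a rel \<Rightarrow> 'a set" where
  "maxima V = {v \<in> Field V. \<forall>w. (v, w) \<in> V \<longrightarrow> w = v}"

definition isucc :: "'a rel \<Rightarrow> 'a \<Rightarrow> 'a set" where
  "isucc V v = {w. (v, w) \<in> V \<and> w \<noteq> v \<and> (\<forall>x. (v, x) \<in> V \<and> (x, w) \<in> V \<longrightarrow> x = v \<or> x = w)}"

text \<open>Branches are maximal chains.\<close>

definition cascade :: "'a rel \<Rightarrow> bool" where
  "cascade V \<longleftrightarrow>
    partial_order_on (Field V) V \<and>
    (\<exists>v. is_root V v) \<and>
    (\<forall>v\<in>Field V. finite {u. (u, v) \<in> V} \<and> {u. (u, v) \<in> V} \<in> Chains V) \<and>
    (\<forall>C. pred_on.maxchain (Field V) (\<lambda>x y. (x, y) \<in> V) C \<longrightarrow> finite C)"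

definition sequential :: "'a rel \<Rightarrow> bool" where
  "sequential V \<longleftrightarrow> (\<forall>v\<in>Field V - maxima V. countable (isucc V v) \<and> infinite (isucc V v))"

definition isucc_rel :: "'a rel \<Rightarrow> 'a rel" where
  "isucc_rel V = {(w, v). w \<in> isucc V v}"

text \<open>The recursions on \<open>isucc_rel V\<close> are well-founded for cascades \<open>V\<close>, see \<open>wf_isucc_rel\<close>.\<close>

definition rank :: "'a rel \<Rightarrow> 'a \<Rightarrow> ordinal" where
  "rank V = wfrec (isucc_rel V)
    (\<lambda>\<rho> v. if v \<in> maxima V then 0 else (LEAST \<alpha>. \<forall>w\<in>isucc V v. \<rho> w < \<alpha>))"

definition cascade_rank :: "'a rel \<Rightarrow> ordinal" where
  "cascade_rank V = rank V (root V)"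

definition monotone_cascade :: "'a rel \<Rightarrow> bool" where
  "monotone_cascade V \<longleftrightarrow> (\<forall>v\<in>Field V - maxima V.
    \<exists>e :: nat \<Rightarrow> 'a. bij_betw e UNIV (isucc V v) \<and> mono (\<lambda>n. rank V (e n)))"


section \<open>Contours\<close>

text \<open>A set belongs to \<open>filter_bind F G\<close> iff it belongs to \<open>G w\<close> for \<open>F\<close>-almost all \<open>w\<close>.\<close>

definition filter_bind :: "'a filter \<Rightarrow> ('a \<Rightarrow> 'b filter) \<Rightarrow> 'b filter" where
  "filter_bind F G = Abs_filter (\<lambda>P. \<forall>\<^sub>F w in F. eventually P (G w))"

lemma eventually_filter_bind:
  "eventually P (filter_bind F G) \<longleftrightarrow> (\<forall>\<^sub>F w in F. eventually P (G w))"
  unfolding filter_bind_def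
proof (rule eventually_Abs_filter, rule is_filter.intro)
  show "\<forall>\<^sub>F w in F. \<forall>\<^sub>F x in G w. P x \<and> Q x"
    if "\<forall>\<^sub>F w in F. eventually P (G w)" "\<forall>\<^sub>F w in F. eventually Q (G w)" for P Q
    using that by eventually_elim (rule eventually_conj)
  show "\<forall>\<^sub>F w in F. eventually Q (G w)"
    if "\<forall>x. P x \<longrightarrow> Q x" "\<forall>\<^sub>F w in F. eventually P (G w)" for P Q
    by (rule eventually_mono[OF that(2)], erule eventually_mono) (use that(1) in blast)
qed simp

abbreviation cofinite_on :: "'a set \<Rightarrow> 'a filter" where
  "cofinite_on A \<equiv> inf cofinite (principal A)"

lemma eventually_cofinite_on:
  "eventually P (cofinite_on A) \<longleftrightarrow> finite {x \<in> A. \<not> P x}"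
  by (simp add: eventually_inf_principal eventually_cofinite)

text \<open>
  A natural number \<open>n\<close> occurring as an element of a cascade is represented by \<open>Inl n\<close>, all other
  objects are of the form \<open>Inr a\<close>.  For a cascade \<open>V\<close> whose maximal elements are natural numbers,
  \<open>contour_at V v\<close> is the contour of the cascade of all elements of \<open>V\<close> above \<open>v\<close>; immediate
  successors, maximal elements and ranks in that cascade are the same as in \<open>V\<close>.
\<close>

definition contour_at :: "(nat + 'a) rel \<Rightarrow> nat + 'a \<Rightarrow> nat filter" where
  "contour_at V = wfrec (isucc_rel V)
    (\<lambda>\<Phi> v. if v \<in> maxima V then principal {n. v = Inl n}
      else if rank V v = 1 then cofinite_on {n. Inl n \<in> maxima V \<and> (v, Inl n) \<in> V}
      else filter_bind (cofinite_on (isucc V v)) \<Phi>)"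

definition contour :: "(nat + 'a) rel \<Rightarrow> nat filter" where
  "contour V = contour_at V (root V)"

text \<open>
  Sequential cascades are countable, so the carrier type \<open>nat + nat\<close>, which provides countably
  many elements besides the natural numbers, accommodates an isomorphic copy of each of them with
  the same maximal elements.
\<close>

definition monotone_sequential_contour :: "ordinal \<Rightarrow> nat filter \<Rightarrow> bool" where
  "monotone_sequential_contour \<beta> F \<longleftrightarrow> (\<exists>V :: (nat + nat) rel.
    cascade V \<and> sequential V \<and> monotone_cascade V \<and> maxima V \<subseteq> range Inl \<and>
    cascade_rank V \<ge> 1 \<and> cascade_rank V = \<beta> \<and> F = contour V)"

text \<open>Inclusion of filters as families of sets is the reverse of \<open>\<le>\<close> on type \<open>filter\<close>.\<close>

definition P_class :: "ordinal \<Rightarrow> nat filter set"  (\<open>\<P>\<close>) where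
  "\<P> \<alpha> = {u. ultrafilter u \<and>
    (\<forall>\<beta>. 1 \<le> \<beta> \<and> \<beta> < \<alpha> \<longrightarrow> (\<exists>F. monotone_sequential_contour \<beta> F \<and> u \<le> F)) \<and>
    \<not> (\<exists>F. monotone_sequential_contour \<alpha> F \<and> u \<le> F)}"


section \<open>Adequacy of the recursive definitions\<close>

lemma wf_isucc_rel:
  assumes "cascade V"
  shows "wf (isucc_rel V)"
proof (rule ccontr)
  let ?chain = "pred_on.chain (Field V) (\<lambda>x y. (x, y) \<in> V)"
  assume "\<not> wf (isucc_rel V)"
  then obtain f where f: "\<And>i. f (Suc i) \<in> isucc V (f i)"
    unfolding wf_iff_no_infinite_down_chain isucc_rel_def by auto
  have po: "trans V" "antisym V" "refl_on (Field V) V"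
    using assms unfolding cascade_def partial_order_on_def preorder_on_def by blast+
  have fF: "f i \<in> Field V" for i
    using f[of i] by (auto simp: isucc_def Field_def)
  have le: "(f i, f j) \<in> V" if "i \<le> j" for i j
    using that
  proof (induction j rule: dec_induct)
    case base show ?case using po(3) fF by (auto simp: refl_on_def)
  next
    case (step n) then show ?case
      using f[of n] po(1) unfolding isucc_def trans_def by blast
  qed
  have inj: "inj f"
  proof (rule linorder_injI)
    fix i j :: nat assume "i < j"
    then have "(f (Suc i), f j) \<in> V" by (intro le) simp
    moreover have "(f i, f (Suc i)) \<in> V" "f (Suc i) \<noteq> f i"
      using f[of i] by (auto simp: isucc_def)
    ultimately show "f i \<noteq> f j"
      using po(2) unfolding antisym_def by metis
  qed
  define C where "C = {x. \<exists>i. (x, f i) \<in> V}"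
  have chainsI: "{u. (u, v) \<in> V} \<in> Chains V" if "v \<in> Field V" for v
    using assms that unfolding cascade_def by blast
  have "?chain C"
    unfolding pred_on.chain_def
  proof (intro conjI ballI)
    show "C \<subseteq> Field V" by (auto simp: C_def Field_def)
    fix x y assume "x \<in> C" "y \<in> C"
    then obtain i j where ij: "(x, f i) \<in> V" "(y, f j) \<in> V" by (auto simp: C_def)
    have "(x, f (max i j)) \<in> V" by (rule transD[OF po(1) ij(1) le]) simp
    moreover have "(y, f (max i j)) \<in> V" by (rule transD[OF po(1) ij(2) le]) simp
    ultimately have "(x, y) \<in> V \<or> (y, x) \<in> V"
      using chainsI[OF fF[of "max i j"]] unfolding Chains_def by blast
    then show "(\<lambda>x y. (x, y) \<in> V)\<^sup>=\<^sup>= x y \<or> (\<lambda>x y. (x, y) \<in> V)\<^sup>=\<^sup>= y x" by auto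
  qed
  moreover have "\<not> (?chain S \<and> C \<subset> S)" for S
  proof
    assume S: "?chain S \<and> C \<subset> S"
    then obtain x where x: "x \<in> S" "x \<notin> C" by blast
    have "(f i, x) \<in> V" for i
    proof -
      have "f i \<in> C" using le[of i i] by (auto simp: C_def)
      then have "f i \<in> S" "f i \<noteq> x" using S x by auto
      then have "(f i, x) \<in> V \<or> (x, f i) \<in> V"
        using S x(1) unfolding pred_on.chain_def by auto
      then show ?thesis using x(2) by (auto simp: C_def)
    qed
    then have "range f \<subseteq> {u. (u, x) \<in> V}" "x \<in> Field V"
      by (auto simp: Field_def)
    moreover from this(2) have "finite {u. (u, x) \<in> V}"
      using assms unfolding cascade_def by blast
    ultimately have "finite (range f)" by (auto intro: finite_subset)
    then show False using range_inj_infinite[OF inj] by blast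
  qed
  ultimately have "pred_on.maxchain (Field V) (\<lambda>x y. (x, y) \<in> V) C"
    unfolding pred_on.maxchain_def by blast
  then have "finite C" using assms unfolding cascade_def by blast
  moreover have "range f \<subseteq> C" using le by (auto simp: C_def)
  ultimately show False using range_inj_infinite[OF inj] by (auto dest: finite_subset)
qed

lemma root_eq:
  assumes "cascade V" "is_root V v"
  shows "root V = v"
  unfolding root_def
proof (rule the_equality)
  show "is_root V v" by fact
  fix w assume "is_root V w"
  with assms(2) have "(w, v) \<in> V" "(v, w) \<in> V" by (simp_all add: is_root_def)
  moreover have "antisym V"
    using assms(1) unfolding cascade_def partial_order_on_def by blast
  ultimately show "w = v" by (simp add: antisymD)
qed

lemmas rank_wfrec = def_wfrec[OF rank_def[THEN eq_reflection] wf_isucc_rel]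

lemma rank_maximal: "cascade V \<Longrightarrow> v \<in> maxima V \<Longrightarrow> rank V v = 0"
  by (simp add: rank_wfrec)

lemma rank_not_maximal:
  assumes "cascade V" "v \<notin> maxima V"
  shows "rank V v = (LEAST \<alpha>. \<forall>w\<in>isucc V v. rank V w < \<alpha>)"
proof -
  have "(\<forall>w\<in>isucc V v. cut (rank V) (isucc_rel V) v w < \<alpha>) \<longleftrightarrow> (\<forall>w\<in>isucc V v. rank V w < \<alpha>)"
    for \<alpha>
    by (auto simp: cut_def isucc_rel_def)
  then show ?thesis
    using rank_wfrec[OF assms(1), of v] assms(2) by (simp only: if_False)
qed

lemma rank_less_omega1:
  assumes "cascade V" "sequential V" "v \<in> Field V"
  shows "rank V v < \<omega>\<^sub>1"
  using assms(3)
proof (induction v rule: wf_induct_rule[OF wf_isucc_rel[OF assms(1)]])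
  case (1 v)
  show ?case
  proof (cases "v \<in> maxima V")
    case True
    have "0 < \<omega>\<^sub>1" using countable_bounded_below_omega1[of "{}"]
      by (meson countable_empty empty_iff le_less_trans zero_ordinal_le)
    with True assms(1) show ?thesis by (simp add: rank_maximal)
  next
    case False
    have "rank V w < \<omega>\<^sub>1" if "w \<in> isucc V v" for w
      using 1 that by (auto simp: isucc_rel_def isucc_def Field_def)
    moreover have "countable (rank V ` isucc V v)"
      using assms(2) False 1(2) by (simp add: sequential_def)
    ultimately obtain b where b: "b < \<omega>\<^sub>1" "\<forall>w\<in>isucc V v. rank V w < b"
      using countable_bounded_below_omega1[of "rank V ` isucc V v"] by auto
    have "rank V v \<le> b"
      unfolding rank_not_maximal[OF assms(1) False] using b(2) by (rule Least_le)
    then show ?thesis using b(1) by (rule le_less_trans)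
  qed
qed

lemma rank_isucc_less:
  assumes "cascade V" "sequential V" "w \<in> isucc V v"
  shows "rank V w < rank V v"
proof -
  have v: "v \<notin> maxima V"
    using assms(3) by (auto simp: isucc_def maxima_def)
  have "\<forall>w\<in>isucc V v. rank V w < \<omega>\<^sub>1"
    using rank_less_omega1[OF assms(1,2)] by (auto simp: isucc_def Field_def)
  then have "\<forall>w\<in>isucc V v. rank V w < rank V v"
    unfolding rank_not_maximal[OF assms(1) v] by (rule LeastI)
  then show ?thesis using assms(3) by (rule bspec)
qed

lemmas contour_at_wfrec =
  def_wfrec[OF contour_at_def[THEN eq_reflection] wf_isucc_rel]

lemma contour_at_maximal:
  assumes "cascade V" "v \<in> maxima V" "v = Inl n"
  shows "eventually P (contour_at V v) \<longleftrightarrow> P n"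
  using assms(2,3) by (simp add: contour_at_wfrec[OF assms(1)] eventually_principal)

lemma contour_at_rank_1:
  assumes "cascade V" "v \<notin> maxima V" "rank V v = 1"
  shows "contour_at V v = cofinite_on {n. Inl n \<in> maxima V \<and> (v, Inl n) \<in> V}"
  using assms(2,3) by (simp add: contour_at_wfrec[OF assms(1), of v])

lemma contour_at_rank_not_1:
  assumes "cascade V" "v \<notin> maxima V" "rank V v \<noteq> 1"
  shows "eventually P (contour_at V v) \<longleftrightarrow>
    finite {w \<in> isucc V v. \<not> eventually P (contour_at V w)}"
proof -
  have "contour_at V v = filter_bind (cofinite_on (isucc V v)) (cut (contour_at V) (isucc_rel V) v)"
    using assms(2,3) contour_at_wfrec[OF assms(1), of v] by (simp only: if_False)
  moreover have "{w \<in> isucc V v. \<not> eventually P (cut (contour_at V) (isucc_rel V) v w)} =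
    {w \<in> isucc V v. \<not> eventually P (contour_at V w)}"
    by (auto simp: cut_def isucc_rel_def)
  ultimately show ?thesis
    by (simp only: eventually_filter_bind eventually_cofinite_on)
qed

end

theory Submission
  imports Defs "HOL-Library.Disjoint_Sets" "HOL-Library.Nat_Bijection"
begin

text \<open>
  Call a set null for a filter if its complement belongs to the filter.  The bonding maps
  \<open>\<pi> k\<close> with \<open>filtermap (\<pi> k) (p (Suc k)) = p k\<close> can be taken surjective, and then countably many
  threads of their inverse limit carry surjections \<open>g k\<close> from \<open>\<nat>\<close> to \<open>\<nat>\<close> with
  \<open>g k = \<pi> k \<circ> g (Suc k)\<close> (\<open>surjective_tower\<close>).  Every ultrafilter \<open>u\<close> whose image under each \<open>g k\<close>
  is \<open>p k\<close> lies above all \<open>p k\<close>, strictly so because \<open>p k\<close> does not lie above \<open>p (Suc k)\<close>, and it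
  contains contours of all ranks below \<open>\<xi>\<close>, because contours can be pulled back along the surjection
  \<open>g 0\<close> (\<open>contour_on_pullback\<close>).  What has to be arranged is that \<open>u\<close> contains no contour of rank \<open>\<xi>\<close>.

  A family of sets is called compatible if each \<open>g k\<close> maps each of its finite intersections onto a
  set that is not null for \<open>p k\<close>.  A maximal compatible family is an ultrafilter with the required
  images.  There are only continuum many contours, so it suffices to build a compatible family in
  continuum many steps, where each step adds a null set of one contour of rank \<open>\<xi>\<close>.  Since
  \<open>\<bb> = \<cc>\<close>, fewer than \<open>\<bb>\<close> sets have been added before any step.

  A step (\<open>compatible_avoid_contour\<close>) rests on two facts about a contour that is the limit of
  contours \<open>F n\<close> with disjoint supports \<open>X n\<close>.  First, for each \<open>k\<close> and each finite intersection \<open>S\<close> of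
  the family there is a subset \<open>K\<close> of \<open>S\<close> whose image is not null for \<open>p k\<close>, although each \<open>K \<inter> X n\<close>
  is null for \<open>F n\<close> and has a null image (\<open>transversal_lift\<close>).  The reason is that the
  images of the null subsets of \<open>S\<close> form an ideal which either contains the whole image of \<open>S\<close> or has a
  dual filter that contains a contour of the same rank (\<open>contour_image_dichotomy\<close>), whereas \<open>p k\<close>
  contains no contour of rank \<open>\<xi>\<close>.
  Second, the null sets of a contour have a base that is indexed monotonically by functions on \<open>\<nat>\<close>
  (\<open>contour_null_base\<close>), so that fewer than \<open>\<bb>\<close> such sets \<open>K\<close> are covered by a single null set of the
  contour up to finitely many of the pieces \<open>K \<inter> X n\<close> (\<open>common_null_cover\<close>).

  All of this is done for an inductive description of contours, \<open>contour_on\<close>, which mentions filters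
  and their supports only; its agreement with the contours of cascades is
  \<open>monotone_sequential_contour_iff\<close>.
\<close>

section \<open>Null sets of a filter\<close>

definition null :: "'a filter \<Rightarrow> 'a set \<Rightarrow> bool" where
  "null F A \<longleftrightarrow> eventually (\<lambda>x. x \<notin> A) F"

lemma null_mono: "null F B \<Longrightarrow> A \<subseteq> B \<Longrightarrow> null F A"
  unfolding null_def by (erule eventually_mono) blast

lemma null_Un_iff: "null F (A \<union> B) \<longleftrightarrow> null F A \<and> null F B"
  by (simp add: null_def eventually_conj_iff)

lemma null_UN_finite: "finite I \<Longrightarrow> (\<And>i. i \<in> I \<Longrightarrow> null F (A i)) \<Longrightarrow> null F (\<Union>i\<in>I. A i)"
  by (simp add: null_def eventually_ball_finite_distrib)

lemma null_finite: "F \<le> cofinite \<Longrightarrow> finite A \<Longrightarrow> null F A"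
  unfolding null_def by (erule filter_leD) (simp add: eventually_cofinite)

lemma null_filter_leD: "F \<le> G \<Longrightarrow> null G A \<Longrightarrow> null F A"
  unfolding null_def by (rule filter_leD)

lemma null_filter_bind: "null (filter_bind F G) A \<longleftrightarrow> (\<forall>\<^sub>F w in F. null (G w) A)"
  by (simp add: null_def eventually_filter_bind)

lemma null_cofinite_on: "null (cofinite_on M) A \<longleftrightarrow> finite (M \<inter> A)"
  by (simp add: null_def eventually_cofinite_on Int_def)

lemma not_null_ultrafilter:
  assumes "ultrafilter u"
  shows "\<not> null u A \<longleftrightarrow> null u (- A)"
proof
  show "null u (- A)" if "\<not> null u A"
    using assms that unfolding ultrafilter_def null_def by auto
  show "\<not> null u A" if "null u (- A)"
  proof
    assume "null u A"
    with that have "eventually (\<lambda>_. False) u"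
      unfolding null_def by eventually_elim simp
    with assms show False by (simp add: ultrafilter_def eventually_False)
  qed
qed

section \<open>Contours as iterated limits of filters\<close>

text \<open>
  The first argument is the rank, the second a set in the filter.  Keeping track of such supports
  makes it possible to express by disjointness what the tree structure of a cascade provides.
\<close>

inductive contour_on :: "ordinal \<Rightarrow> nat set \<Rightarrow> nat filter \<Rightarrow> bool" where
  cofinite: "infinite M \<Longrightarrow> contour_on 1 M (cofinite_on M)"
| bind: "contour_on (LEAST \<alpha>. \<forall>n. \<beta> n < \<alpha>) (\<Union>n. X n) (filter_bind sequentially F)"
  if "\<And>n. contour_on (\<beta> n) (X n) (F n)" "mono \<beta>" "disjoint_family X"

lemma contour_on_support: "contour_on \<alpha> X F \<Longrightarrow> null F (- X)"
proof (induction rule: contour_on.induct)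
  case (bind \<beta> X F)
  then show ?case
    unfolding null_filter_bind by (blast intro: always_eventually null_mono)
qed (simp add: null_cofinite_on)

lemma contour_on_free: "contour_on \<alpha> X F \<Longrightarrow> finite A \<Longrightarrow> null F A"
  by (induction rule: contour_on.induct) (simp_all add: null_cofinite_on null_filter_bind)

lemma contour_on_le_cofinite:
  assumes "contour_on \<alpha> X F"
  shows "F \<le> cofinite"
proof (rule filter_leI)
  fix P :: "nat \<Rightarrow> bool" assume "eventually P cofinite"
  then have "null F {x. \<not> P x}"
    by (intro contour_on_free[OF assms]) (simp add: eventually_cofinite)
  then show "eventually P F" by (simp add: null_def)
qed

lemma null_Int_support:
  assumes "contour_on \<alpha> X F"
  shows "null F A \<longleftrightarrow> null F (A \<inter> X)"
proof
  assume "null F (A \<inter> X)"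
  then have "null F ((A \<inter> X) \<union> - X)"
    using contour_on_support[OF assms] by (simp add: null_Un_iff)
  then show "null F A" by (rule null_mono) blast
qed (erule null_mono, blast)

text \<open>
  This is where monotonicity of cascades matters: infinitely many of the given ranks have the same
  limit as all of them, so a contour of the full rank survives the loss of all other branches.
\<close>

lemma Least_bound_subseq:
  fixes \<beta> :: "nat \<Rightarrow> 'o::wellorder"
  assumes "mono \<beta>" "strict_mono (r :: nat \<Rightarrow> nat)"
  shows "(LEAST \<alpha>. \<forall>n. \<beta> (r n) < \<alpha>) = (LEAST \<alpha>. \<forall>n. \<beta> n < \<alpha>)"
proof -
  have "\<beta> n \<le> \<beta> (r n)" for n
    using assms by (simp add: monoD strict_mono_imp_increasing)
  then have "(\<forall>n. \<beta> (r n) < \<alpha>) \<longleftrightarrow> (\<forall>n. \<beta> n < \<alpha>)" for \<alpha>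
    by (blast intro: le_less_trans)
  then show ?thesis by simp
qed

section \<open>Contours of cascades\<close>

lemma cascade_order:
  assumes "cascade V"
  shows "trans V" "antisym V" "\<And>v. v \<in> Field V \<Longrightarrow> (v, v) \<in> V"
  using assms unfolding cascade_def partial_order_on_def preorder_on_def refl_on_def by blast+

lemma root_is_root:
  assumes "cascade V"
  shows "is_root V (root V)"
proof -
  obtain v where v: "is_root V v" using assms by (auto simp: cascade_def)
  with root_eq[OF assms v] show ?thesis by simp
qed

lemma rank_pos:
  assumes V: "cascade V" "sequential V" "v \<in> Field V" "v \<notin> maxima V"
  shows "0 < rank V v"
proof -
  have "infinite (isucc V v)" using V(2-4) by (simp add: sequential_def)
  then obtain w where "w \<in> isucc V v" by (metis ex_in_conv finite.emptyI)
  from rank_isucc_less[OF V(1,2) this] zero_ordinal_le show ?thesis by (rule le_less_trans[rotated])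
qed

text \<open>
  Predecessors form a chain, so the trees above different immediate successors are disjoint.
\<close>

lemma isucc_eq_if_common_upper_bound:
  assumes "cascade V" "u \<in> isucc V v" "w \<in> isucc V v" "(u, x) \<in> V" "(w, x) \<in> V"
  shows "u = w"
proof -
  have "{y. (y, x) \<in> V} \<in> Chains V"
    using assms(1,4) by (auto simp: cascade_def Field_def)
  then have "(u, w) \<in> V \<or> (w, u) \<in> V" using assms(4,5) by (simp add: Chains_def)
  then show ?thesis using assms(2,3) unfolding isucc_def by blast
qed

text \<open>
  Below a node of rank above \<open>1\<close> only finitely many immediate successors are maximal, by
  monotonicity.  They change neither the rank nor the contour, and dropping them leaves
  a sequence of successors to which the induction hypothesis applies.
\<close>

lemma contour_on_of_cascade:
  fixes V :: "(nat + 'a) rel"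
  assumes V: "cascade V" "sequential V" "monotone_cascade V" "maxima V \<subseteq> range Inl"
    and "v \<in> Field V" "v \<notin> maxima V"
  shows "\<exists>X\<subseteq>{n. (v, Inl n) \<in> V}. contour_on (rank V v) X (contour_at V v)"
  using assms(5,6)
proof (induction v rule: wf_induct_rule[OF wf_isucc_rel[OF V(1)]])
  case (1 v)
  have inf: "infinite (isucc V v)" using V(2) 1(2,3) by (simp add: sequential_def)
  have Field: "w \<in> Field V" if "w \<in> isucc V v" for w
    using that by (auto simp: isucc_def Field_def)
  have max_iff: "w \<in> maxima V \<longleftrightarrow> rank V w = 0" if "w \<in> isucc V v" for w
    using rank_maximal[OF V(1)] rank_pos[OF V(1,2) Field[OF that]] by fastforce
  show ?case
  proof (cases "rank V v = 1")
    case True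
    let ?X = "{n. Inl n \<in> maxima V \<and> (v, Inl n) \<in> V}"
    have "isucc V v \<subseteq> Inl ` ?X"
    proof
      fix w assume w: "w \<in> isucc V v"
      have "rank V w < 1" using rank_isucc_less[OF V(1,2) w] True by simp
      then have "w \<in> maxima V" using max_iff[OF w] by (simp add: less_one_ordinal_iff)
      moreover from this obtain n where "w = Inl n" using V(4) by auto
      ultimately show "w \<in> Inl ` ?X" using w by (auto simp: isucc_def)
    qed
    with inf have "infinite ?X" by (meson finite_imageI finite_subset)
    then have "contour_on 1 ?X (cofinite_on ?X)" by (rule contour_on.cofinite)
    then show ?thesis
      using contour_at_rank_1[OF V(1) 1(3) True] True by (intro exI[of _ ?X]) auto
  next
    case False
    obtain e :: "nat \<Rightarrow> nat + 'a"
      where e: "bij_betw e UNIV (isucc V v)" "mono (\<lambda>n. rank V (e n))"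
      using bspec[OF V(3)[unfolded monotone_cascade_def] DiffI[OF 1(2,3)]] by (elim exE conjE)
    have e_in: "e n \<in> isucc V v" for n using e(1) by (auto simp: bij_betw_def)
    have e_range: "isucc V v = range e" using e(1) by (simp add: bij_betw_def)
    have rank_v: "rank V v = (LEAST \<alpha>. \<forall>n. rank V (e n) < \<alpha>)"
      unfolding rank_not_maximal[OF V(1) 1(3)] e_range by simp
    \<comment> \<open>If all successors were maximal, the rank would be \<open>1\<close>.\<close>
    have "\<exists>N. rank V (e N) \<noteq> 0"
    proof (rule ccontr)
      assume "\<not> ?thesis"
      then have "rank V v = (LEAST \<alpha>. 0 < \<alpha>)" unfolding rank_v by simp
      then have "rank V v \<le> 1" using Least_le[of "\<lambda>\<alpha>. 0 < \<alpha>" "1 :: ordinal"]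
        by (simp add: less_one_ordinal_iff)
      moreover have "\<not> rank V v < 1"
        using rank_pos[OF V(1,2) 1(2,3)] by (simp add: less_one_ordinal_iff)
      ultimately show False using False by simp
    qed
    then obtain N where N: "rank V (e N) \<noteq> 0" by blast
    define d where "d n = e (n + N)" for n
    have d: "d n \<in> isucc V v" "d n \<notin> maxima V" for n
    proof -
      show dn: "d n \<in> isucc V v" using e_in by (simp add: d_def)
      have "0 < rank V (e N)" using N zero_ordinal_le[of "rank V (e N)"] by (simp add: less_le)
      also have "rank V (e N) \<le> rank V (d n)" using monoD[OF e(2), of N "n + N"] by (simp add: d_def)
      finally show "d n \<notin> maxima V" using max_iff[OF dn] by auto
    qed
    have "\<forall>n. \<exists>X\<subseteq>{x. (d n, Inl x) \<in> V}. contour_on (rank V (d n)) X (contour_at V (d n))"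
      using 1(1) d Field by (simp add: isucc_rel_def)
    from choice[OF this] obtain X where X: "\<And>n. X n \<subseteq> {x. (d n, Inl x) \<in> V}"
      "\<And>n. contour_on (rank V (d n)) (X n) (contour_at V (d n))" by blast
    have "disjoint_family X"
      unfolding disjoint_family_on_def
    proof (intro ballI impI)
      fix m n :: nat assume "m \<noteq> n"
      then have "d m \<noteq> d n" using e(1) by (auto simp: d_def bij_betw_def dest: injD)
      then show "X m \<inter> X n = {}"
        using X(1) isucc_eq_if_common_upper_bound[OF V(1) d(1) d(1)] by blast
    qed
    moreover have "mono (\<lambda>n. rank V (d n))" using e(2) by (simp add: mono_def d_def)
    ultimately have "contour_on (LEAST \<alpha>. \<forall>n. rank V (d n) < \<alpha>) (\<Union>n. X n)
        (filter_bind sequentially (\<lambda>n. contour_at V (d n)))"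
      by (intro contour_on.bind X(2))
    moreover have "(LEAST \<alpha>. \<forall>n. rank V (d n) < \<alpha>) = rank V v"
      unfolding rank_v d_def by (rule Least_bound_subseq[OF e(2)]) (simp add: strict_mono_def)
    moreover have "filter_bind sequentially (\<lambda>n. contour_at V (d n)) = contour_at V v"
    proof (rule filter_eqI)
      fix P
      have "eventually P (contour_at V v) \<longleftrightarrow> finite {w \<in> isucc V v. \<not> eventually P (contour_at V w)}"
        by (rule contour_at_rank_not_1[OF V(1) 1(3) False])
      also have "{w \<in> isucc V v. \<not> eventually P (contour_at V w)} =
          e ` {n. \<not> eventually P (contour_at V (e n))}"
        unfolding e_range by auto
      also have "finite \<dots> \<longleftrightarrow> finite {n. \<not> eventually P (contour_at V (e n))}"
        by (rule finite_image_iff) (use e(1) in \<open>auto simp: bij_betw_def intro: inj_on_subset\<close>)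
      also have "\<dots> \<longleftrightarrow> (\<forall>\<^sub>F n in sequentially. eventually P (contour_at V (e n)))"
        by (simp add: cofinite_eq_sequentially[symmetric] eventually_cofinite)
      also have "\<dots> \<longleftrightarrow> (\<forall>\<^sub>F n in sequentially. eventually P (contour_at V (d n)))"
        unfolding d_def
        by (rule eventually_sequentially_seg[symmetric, of "\<lambda>n. eventually P (contour_at V (e n))"])
      finally show "eventually P (filter_bind sequentially (\<lambda>n. contour_at V (d n))) \<longleftrightarrow>
          eventually P (contour_at V v)"
        by (simp add: eventually_filter_bind)
    qed
    moreover have "(\<Union>n. X n) \<subseteq> {n. (v, Inl n) \<in> V}"
      using X(1) d(1) transD[OF cascade_order(1)[OF V(1)]] unfolding isucc_def by blast
    ultimately show ?thesis by auto
  qed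
qed

lemma contour_on_of_monotone_sequential_contour:
  assumes "monotone_sequential_contour \<beta> F"
  shows "\<exists>X. contour_on \<beta> X F"
proof -
  obtain V :: "(nat + nat) rel" where V: "cascade V" "sequential V" "monotone_cascade V"
    "maxima V \<subseteq> range Inl" "1 \<le> rank V (root V)" "rank V (root V) = \<beta>" "F = contour_at V (root V)"
    using assms by (auto simp: monotone_sequential_contour_def cascade_rank_def contour_def)
  have "root V \<in> Field V" using root_is_root[OF V(1)] by (simp add: is_root_def)
  moreover have "root V \<notin> maxima V"
  proof
    assume "root V \<in> maxima V"
    then have "rank V (root V) < 1" using rank_maximal[OF V(1)] by (simp add: less_one_ordinal_iff)
    with V(5) show False by simp
  qed
  ultimately show ?thesis using contour_on_of_cascade[OF V(1-4)] V(6,7) by blast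
qed

text \<open>
  Conversely, a sequence of cascades with disjoint fields is joined below a new root.  All notions at
  the old nodes depend only on what lies above them and hence do not change.
\<close>

locale grafting =
  fixes r :: "nat + 'a" and V :: "nat \<Rightarrow> (nat + 'a) rel"
  assumes V: "\<And>n. cascade (V n)" "\<And>n. sequential (V n)" "\<And>n. monotone_cascade (V n)"
    and disjoint: "\<And>m n. m \<noteq> n \<Longrightarrow> Field (V m) \<inter> Field (V n) = {}"
    and fresh: "\<And>n. r \<notin> Field (V n)"
    and mono_rank: "mono (\<lambda>n. cascade_rank (V n))"
begin

definition graft :: "(nat + 'a) rel" where
  "graft = {(r, r)} \<union> {r} \<times> (\<Union>n. Field (V n)) \<union> (\<Union>n. V n)"

lemma Field_graft: "Field graft = insert r (\<Union>n. Field (V n))"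
  unfolding graft_def Field_def by auto

lemma V_Field: "(x, y) \<in> V n \<Longrightarrow> x \<in> Field (V n) \<and> y \<in> Field (V n)"
  by (auto simp: Field_def)

lemma unique_index: "x \<in> Field (V m) \<Longrightarrow> x \<in> Field (V n) \<Longrightarrow> m = n"
  using disjoint by blast

lemma graft_above: "x \<in> Field (V n) \<Longrightarrow> (x, y) \<in> graft \<longleftrightarrow> (x, y) \<in> V n"
  using fresh[of n] unique_index V_Field unfolding graft_def by blast

lemma graft_below: "y \<in> Field (V n) \<Longrightarrow> (x, y) \<in> graft \<longleftrightarrow> x = r \<or> (x, y) \<in> V n"
  using fresh[of n] unique_index V_Field unfolding graft_def by blast

lemma graft_root: "(r, y) \<in> graft \<longleftrightarrow> y \<in> Field graft" "(x, r) \<in> graft \<longleftrightarrow> x = r"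
  unfolding Field_graft using fresh V_Field unfolding graft_def by blast+

lemma Field_graft_cases:
  assumes "x \<in> Field graft"
  obtains "x = r" | n where "x \<in> Field (V n)"
  using assms unfolding Field_graft by blast

lemma root_V: "root (V n) \<in> Field (V n)" "x \<in> Field (V n) \<Longrightarrow> (root (V n), x) \<in> V n"
  using root_is_root[OF V(1)[of n]] by (simp_all add: is_root_def)

lemma is_root_graft: "is_root graft r"
  unfolding is_root_def graft_root by (simp add: Field_graft)

text \<open>
  Elements of different cascades are incomparable, so apart from the new root a chain stays inside one
  of the cascades.
\<close>

lemma chain_graft_part:
  assumes "pred_on.chain (Field graft) (\<lambda>x y. (x, y) \<in> graft) C" "x \<in> C" "x \<in> Field (V n)"
  shows "pred_on.chain (Field (V n)) (\<lambda>x y. (x, y) \<in> V n) (C - {r})"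
proof -
  have comparable: "a = b \<or> (a, b) \<in> graft \<or> (b, a) \<in> graft" if "a \<in> C" "b \<in> C" for a b
    using assms(1) that unfolding pred_on.chain_def by blast
  have part: "y \<in> Field (V n)" if y: "y \<in> C" "y \<noteq> r" for y
    using comparable[OF assms(2) y(1)] graft_above[OF assms(3)] graft_below[OF assms(3)] y(2) assms(3)
      V_Field by blast
  show ?thesis
    unfolding pred_on.chain_def
  proof (intro conjI ballI)
    show "C - {r} \<subseteq> Field (V n)" using part by blast
    fix a b assume ab: "a \<in> C - {r}" "b \<in> C - {r}"
    then have "a = b \<or> (a, b) \<in> V n \<or> (b, a) \<in> V n"
      using comparable[of a b] part graft_above by blast
    then show "(\<lambda>x y. (x, y) \<in> V n)\<^sup>=\<^sup>= a b \<or> (\<lambda>x y. (x, y) \<in> V n)\<^sup>=\<^sup>= b a" by auto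
  qed
qed

lemma maxchain_graft_finite:
  assumes "pred_on.maxchain (Field graft) (\<lambda>x y. (x, y) \<in> graft) C"
  shows "finite C"
proof (cases "C \<subseteq> {r}")
  case True
  then show ?thesis by (rule finite_subset) simp
next
  case False
  have C: "pred_on.chain (Field graft) (\<lambda>x y. (x, y) \<in> graft) C"
    and max: "\<And>S. pred_on.chain (Field graft) (\<lambda>x y. (x, y) \<in> graft) S \<Longrightarrow> \<not> C \<subset> S"
    using assms unfolding pred_on.maxchain_def by blast+
  obtain x where x: "x \<in> C" "x \<noteq> r" using False by blast
  then have "x \<in> Field graft" using C unfolding pred_on.chain_def by blast
  then obtain n where n: "x \<in> Field (V n)" using x(2) by (auto simp: Field_graft)
  have "\<not> (pred_on.chain (Field (V n)) (\<lambda>x y. (x, y) \<in> V n) S \<and> C - {r} \<subset> S)" for S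
  proof
    assume S: "pred_on.chain (Field (V n)) (\<lambda>x y. (x, y) \<in> V n) S \<and> C - {r} \<subset> S"
    then have SF: "S \<subseteq> Field (V n)" unfolding pred_on.chain_def by blast
    have cS: "a = b \<or> (a, b) \<in> V n \<or> (b, a) \<in> V n" if "a \<in> S" "b \<in> S" for a b
      using S that unfolding pred_on.chain_def by blast
    have "pred_on.chain (Field graft) (\<lambda>x y. (x, y) \<in> graft) (insert r S)"
      unfolding pred_on.chain_def
    proof (intro conjI ballI)
      show sub: "insert r S \<subseteq> Field graft" using SF by (auto simp: Field_graft)
      fix a b assume ab: "a \<in> insert r S" "b \<in> insert r S"
      have "a = b \<or> (a, b) \<in> graft \<or> (b, a) \<in> graft"
      proof (cases "a = r \<or> b = r")
        case True
        then show ?thesis using ab sub graft_root(1) by blast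
      next
        case False
        then show ?thesis using ab cS[of a b] SF graft_above by blast
      qed
      then show "(\<lambda>x y. (x, y) \<in> graft)\<^sup>=\<^sup>= a b \<or> (\<lambda>x y. (x, y) \<in> graft)\<^sup>=\<^sup>= b a" by auto
    qed
    moreover have "C \<subset> insert r S" using S SF fresh[of n] by blast
    ultimately show False using max by blast
  qed
  with chain_graft_part[OF C x(1) n]
  have "pred_on.maxchain (Field (V n)) (\<lambda>x y. (x, y) \<in> V n) (C - {r})"
    unfolding pred_on.maxchain_def by blast
  then have "finite (C - {r})" using V(1)[of n] unfolding cascade_def by blast
  then show ?thesis by simp
qed

lemma cascade_graft: "cascade graft"
  unfolding cascade_def
proof (intro conjI ballI allI impI)
  show "partial_order_on (Field graft) graft"
    unfolding partial_order_on_def preorder_on_def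
  proof (intro conjI)
    show "graft \<subseteq> Field graft \<times> Field graft" by (auto simp: Field_def)
    show "refl_on (Field graft) graft"
    proof (rule refl_onI)
      fix x assume "x \<in> Field graft"
      then show "(x, x) \<in> graft"
        by (cases rule: Field_graft_cases) (auto simp: graft_root Field_graft graft_above cascade_order(3)[OF V(1)])
    qed
    show "trans graft"
    proof (rule transI)
      fix x y z assume xy: "(x, y) \<in> graft" and yz: "(y, z) \<in> graft"
      have "x \<in> Field graft" "z \<in> Field graft" using xy yz by (auto simp: Field_def)
      then show "(x, z) \<in> graft"
      proof (cases rule: Field_graft_cases)
        case 1
        then show ?thesis using \<open>z \<in> Field graft\<close> graft_root(1) by simp
      next
        case (2 n)
        then have "(x, y) \<in> V n" using xy graft_above by blast
        moreover from this have "(y, z) \<in> V n" using yz graft_above V_Field by blast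
        ultimately show ?thesis
          using transD[OF cascade_order(1)[OF V(1)]] graft_above[OF 2] by blast
      qed
    qed
    show "antisym graft"
    proof (rule antisymI)
      fix x y assume xy: "(x, y) \<in> graft" and yx: "(y, x) \<in> graft"
      have "x \<in> Field graft" using xy by (auto simp: Field_def)
      then show "x = y"
      proof (cases rule: Field_graft_cases)
        case 1
        then show ?thesis using yx graft_root(2) by simp
      next
        case (2 n)
        then have "(x, y) \<in> V n" using xy graft_above by blast
        moreover from this have "(y, x) \<in> V n" using yx graft_above V_Field by blast
        ultimately show ?thesis using antisymD[OF cascade_order(2)[OF V(1)]] by blast
      qed
    qed
  qed
  show "\<exists>v. is_root graft v" using is_root_graft ..
next
  fix v assume "v \<in> Field graft"
  then show "finite {u. (u, v) \<in> graft}"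
  proof (cases rule: Field_graft_cases)
    case 1
    then show ?thesis by (simp add: graft_root)
  next
    case (2 n)
    then have "{u. (u, v) \<in> graft} = insert r {u. (u, v) \<in> V n}" using graft_below by blast
    then show ?thesis using V(1)[of n] 2 unfolding cascade_def by simp
  qed
next
  fix v assume v: "v \<in> Field graft"
  then show "{u. (u, v) \<in> graft} \<in> Chains graft"
  proof (cases rule: Field_graft_cases)
    case 1
    then show ?thesis by (simp add: graft_root Chains_def Field_graft)
  next
    case (2 n)
    have *: "{u. (u, v) \<in> graft} = insert r {u. (u, v) \<in> V n}" using graft_below[OF 2] by blast
    have "{u. (u, v) \<in> V n} \<in> Chains (V n)" using V(1)[of n] 2 unfolding cascade_def by blast
    then have "(a, b) \<in> graft \<or> (b, a) \<in> graft" if "(a, v) \<in> V n" "(b, v) \<in> V n" for a b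
      using that graft_above V_Field unfolding Chains_def by blast
    moreover have "(r, a) \<in> graft" if "a \<in> {u. (u, v) \<in> graft}" for a
      using that graft_root(1) by (auto simp: Field_def)
    ultimately show ?thesis unfolding Chains_def * by (auto simp: *)
  qed
qed (rule maxchain_graft_finite)

lemma root_graft: "root graft = r"
  by (rule root_eq[OF cascade_graft is_root_graft])

lemma isucc_graft: "x \<in> Field (V n) \<Longrightarrow> isucc graft x = isucc (V n) x"
  unfolding isucc_def using graft_above V_Field by blast

lemma isucc_graft_root: "isucc graft r = range (\<lambda>n. root (V n))"
proof (rule set_eqI, rule iffI)
  fix w assume w: "w \<in> isucc graft r"
  then have "w \<in> Field graft" "w \<noteq> r" by (auto simp: isucc_def Field_def)
  then obtain n where n: "w \<in> Field (V n)" by (auto simp: Field_graft)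
  have "(r, root (V n)) \<in> graft" "(root (V n), w) \<in> graft"
    using root_V(1)[of n] root_V(2)[OF n] graft_root(1) graft_above by (auto simp: Field_graft)
  then have "w = root (V n)" using w root_V(1)[of n] fresh[of n] unfolding isucc_def by blast
  then show "w \<in> range (\<lambda>n. root (V n))" by blast
next
  fix w assume "w \<in> range (\<lambda>n. root (V n))"
  then obtain n where w: "w = root (V n)" by blast
  have wF: "w \<in> Field (V n)" using w root_V(1) by simp
  have "x = r \<or> x = w" if "(x, w) \<in> graft" for x
  proof (rule ccontr)
    assume x: "\<not> ?thesis"
    then have "(x, w) \<in> V n" using that graft_below[OF wF] by blast
    moreover from this have "(w, x) \<in> V n" using w root_V(2) V_Field by blast
    ultimately show False using x antisymD[OF cascade_order(2)[OF V(1)]] by blast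
  qed
  moreover have "(r, w) \<in> graft" "w \<noteq> r" using wF fresh[of n] by (auto simp: graft_root Field_graft)
  ultimately show "w \<in> isucc graft r" unfolding isucc_def by blast
qed

lemma inj_root: "inj (\<lambda>n. root (V n))"
  by (rule injI) (metis root_V(1) unique_index)

lemma maxima_graft_part: "x \<in> Field (V n) \<Longrightarrow> x \<in> maxima graft \<longleftrightarrow> x \<in> maxima (V n)"
  unfolding maxima_def using graft_above by (auto simp: Field_graft)

lemma root_not_maximal: "r \<notin> maxima graft"
  using root_V(1)[of 0] fresh[of 0] graft_root(1)[of "root (V 0)"] unfolding maxima_def Field_graft by auto

lemma maxima_graft: "maxima graft = (\<Union>n. maxima (V n))"
proof -
  have "x \<in> maxima graft \<longleftrightarrow> (\<exists>n. x \<in> maxima (V n))" for x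
  proof
    assume x: "x \<in> maxima graft"
    then have "x \<in> Field graft" "x \<noteq> r" using root_not_maximal by (auto simp: maxima_def)
    then obtain n where "x \<in> Field (V n)" by (auto simp: Field_graft)
    then show "\<exists>n. x \<in> maxima (V n)" using x maxima_graft_part by blast
  next
    assume "\<exists>n. x \<in> maxima (V n)"
    then obtain n where n: "x \<in> maxima (V n)" by blast
    then have "x \<in> Field (V n)" by (simp add: maxima_def)
    then show "x \<in> maxima graft" using n maxima_graft_part by blast
  qed
  then show ?thesis by blast
qed

lemma sequential_graft: "sequential graft"
  unfolding sequential_def
proof
  fix x assume x: "x \<in> Field graft - maxima graft"
  then have "x \<in> Field graft" by simp
  then show "countable (isucc graft x) \<and> infinite (isucc graft x)"
  proof (cases rule: Field_graft_cases)
    case 1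
    then show ?thesis using inj_root by (simp add: isucc_graft_root range_inj_infinite)
  next
    case (2 n)
    then show ?thesis using V(2)[of n] x by (simp add: sequential_def isucc_graft maxima_graft_part)
  qed
qed

lemma isucc_Field: "w \<in> isucc (V n) x \<Longrightarrow> w \<in> Field (V n)"
  by (auto simp: isucc_def Field_def)

lemma rank_graft: "x \<in> Field (V n) \<Longrightarrow> rank graft x = rank (V n) x"
proof (induction x rule: wf_induct_rule[OF wf_isucc_rel[OF V(1)[of n]]])
  case (1 x)
  show ?case
  proof (cases "x \<in> maxima (V n)")
    case True
    then show ?thesis
      using 1(2) by (simp add: rank_maximal cascade_graft V(1) maxima_graft_part)
  next
    case False
    have "rank graft w = rank (V n) w" if "w \<in> isucc (V n) x" for w
      using 1(1) that isucc_Field by (simp add: isucc_rel_def)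
    then show ?thesis
      using 1(2) False
      by (simp add: rank_not_maximal cascade_graft V(1) maxima_graft_part isucc_graft cong: ball_cong)
  qed
qed

lemma rank_graft_root_V: "rank graft (root (V n)) = cascade_rank (V n)"
  by (simp add: rank_graft[OF root_V(1)] cascade_rank_def)

lemma rank_graft_root: "rank graft r = (LEAST \<alpha>. \<forall>n. cascade_rank (V n) < \<alpha>)"
  unfolding rank_not_maximal[OF cascade_graft root_not_maximal] isucc_graft_root
  by (simp add: rank_graft_root_V)

lemma monotone_graft: "monotone_cascade graft"
  unfolding monotone_cascade_def
proof
  fix x assume x: "x \<in> Field graft - maxima graft"
  then have "x \<in> Field graft" by simp
  then show "\<exists>e :: nat \<Rightarrow> _. bij_betw e UNIV (isucc graft x) \<and> mono (\<lambda>n. rank graft (e n))"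
  proof (cases rule: Field_graft_cases)
    case 1
    have "bij_betw (\<lambda>n. root (V n)) UNIV (isucc graft r)"
      unfolding isucc_graft_root using inj_root by (rule inj_on_imp_bij_betw)
    moreover have "mono (\<lambda>n. rank graft (root (V n)))"
      using mono_rank by (simp add: rank_graft_root_V)
    ultimately show ?thesis using 1 by blast
  next
    case (2 n)
    then have "x \<in> Field (V n) - maxima (V n)" using x maxima_graft_part by blast
    then obtain e :: "nat \<Rightarrow> _" where e: "bij_betw e UNIV (isucc (V n) x)" "mono (\<lambda>m. rank (V n) (e m))"
      using V(3)[of n] unfolding monotone_cascade_def by blast
    have "e m \<in> isucc (V n) x" for m using e(1) by (auto simp: bij_betw_def)
    then have "e m \<in> Field (V n)" for m by (rule isucc_Field)
    then have "rank graft (e m) = rank (V n) (e m)" for m by (rule rank_graft)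
    then have "mono (\<lambda>m. rank graft (e m))" using e(2) by simp
    with e(1) 2 show ?thesis by (auto simp: isucc_graft)
  qed
qed

lemma contour_at_graft:
  assumes "maxima (V n) \<subseteq> range Inl" "x \<in> Field (V n)"
  shows "contour_at graft x = contour_at (V n) x"
  using assms(2)
proof (induction x rule: wf_induct_rule[OF wf_isucc_rel[OF V(1)[of n]]])
  case (1 x)
  show ?case
  proof (cases "x \<in> maxima (V n)")
    case True
    then obtain k where k: "x = Inl k" using assms(1) by blast
    show ?thesis
      by (rule filter_eqI)
        (use True k 1(2) in \<open>simp add: contour_at_maximal cascade_graft V(1) maxima_graft_part\<close>)
  next
    case False
    then have F: "x \<notin> maxima graft" using 1(2) maxima_graft_part by blast
    show ?thesis
    proof (cases "rank (V n) x = 1")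
      case True
      then have "rank graft x = 1" using 1(2) rank_graft by simp
      moreover have "Inl k \<in> maxima graft \<and> (x, Inl k) \<in> graft \<longleftrightarrow> Inl k \<in> maxima (V n) \<and> (x, Inl k) \<in> V n" for k
        using graft_above[OF 1(2)] maxima_graft_part V_Field by blast
      ultimately show ?thesis
        using contour_at_rank_1[OF cascade_graft F] contour_at_rank_1[OF V(1) False True] by simp
    next
      case nr: False
      have "contour_at graft w = contour_at (V n) w" if "w \<in> isucc (V n) x" for w
        using 1(1) that isucc_Field by (simp add: isucc_rel_def)
      then show ?thesis
        using nr 1(2) False F
        by (intro filter_eqI)
          (simp add: contour_at_rank_not_1 cascade_graft V(1) isucc_graft rank_graft cong: conj_cong)
    qed
  qed
qed

lemma contour_graft:
  assumes "\<And>n. maxima (V n) \<subseteq> range Inl" "rank graft r \<noteq> 1"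
  shows "contour graft = filter_bind sequentially (\<lambda>n. contour (V n))"
proof (rule filter_eqI)
  fix P
  have *: "contour_at graft (root (V n)) = contour (V n)" for n
    by (simp add: contour_at_graft[OF assms(1)] root_V(1) contour_def)
  have "eventually P (contour graft) \<longleftrightarrow> finite {w \<in> isucc graft r. \<not> eventually P (contour_at graft w)}"
    unfolding contour_def root_graft by (rule contour_at_rank_not_1[OF cascade_graft root_not_maximal assms(2)])
  also have "{w \<in> isucc graft r. \<not> eventually P (contour_at graft w)} =
      (\<lambda>n. root (V n)) ` {n. \<not> eventually P (contour (V n))}"
    unfolding isucc_graft_root by (auto simp: *)
  also have "finite \<dots> \<longleftrightarrow> finite {n. \<not> eventually P (contour (V n))}"
    by (rule finite_image_iff) (rule inj_on_subset[OF inj_root subset_UNIV])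
  also have "\<dots> \<longleftrightarrow> eventually P (filter_bind sequentially (\<lambda>n. contour (V n)))"
    by (simp add: eventually_filter_bind cofinite_eq_sequentially[symmetric] eventually_cofinite)
  finally show "eventually P (contour graft) \<longleftrightarrow>
      eventually P (filter_bind sequentially (\<lambda>n. contour (V n)))" .
qed

end

lemma singleton_cascade:
  fixes x :: "nat + 'a"
  defines "S \<equiv> {(x, x)}"
  shows "cascade S" "sequential S" "monotone_cascade S" "Field S = {x}" "maxima S = {x}"
    "cascade_rank S = 0"
proof -
  show F: "Field S = {x}" by (simp add: S_def)
  show M: "maxima S = {x}" by (auto simp: maxima_def S_def)
  have root: "is_root S x" by (simp add: is_root_def S_def)
  show c: "cascade S"
    unfolding cascade_def
  proof (intro conjI ballI allI impI)
    show "partial_order_on (Field S) S"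
      by (simp add: S_def partial_order_on_def preorder_on_def refl_on_def trans_def antisym_def)
    show "\<exists>v. is_root S v" using root ..
    show "finite {u. (u, v) \<in> S}" for v
      by (rule finite_subset[of _ "{x}"]) (auto simp: S_def)
    show "{u. (u, v) \<in> S} \<in> Chains S" for v by (auto simp: S_def Chains_def)
    show "finite C" if "pred_on.maxchain (Field S) (\<lambda>x y. (x, y) \<in> S) C" for C
      by (rule finite_subset[of _ "{x}"])
        (use that in \<open>auto simp: F pred_on.maxchain_def pred_on.chain_def\<close>)
  qed
  show "sequential S" "monotone_cascade S"
    by (simp_all add: sequential_def monotone_cascade_def F M)
  show "cascade_rank S = 0"
    unfolding cascade_rank_def root_eq[OF c root] by (rule rank_maximal[OF c]) (simp add: M)
qed

text \<open>
  The injection \<open>h\<close> names the elements that may serve as inner nodes.  Making it arbitrary provides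
  disjoint supplies of inner nodes for the cascades that are joined, without renaming any of them.
\<close>

lemma cascade_of_contour_on:
  assumes "contour_on \<alpha> X F" "inj (h :: nat \<Rightarrow> nat)"
  shows "\<exists>V :: (nat + nat) rel. cascade V \<and> sequential V \<and> monotone_cascade V \<and>
    maxima V = Inl ` X \<and> Field V \<subseteq> Inl ` X \<union> Inr ` range h \<and> 1 \<le> cascade_rank V \<and>
    cascade_rank V = \<alpha> \<and> contour V = F"
  using assms
proof (induction arbitrary: h rule: contour_on.induct)
  case (cofinite M)
  let ?V = "\<lambda>n. {(Inl (enumerate M n), Inl (enumerate M n))} :: (nat + nat) rel"
  interpret grafting "Inr (h 0)" ?V
    by unfold_locales
      (use cofinite in \<open>auto simp: singleton_cascade mono_def dest: injD[OF inj_enumerate]\<close>)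
  have Max: "maxima graft = Inl ` M"
  proof -
    have "maxima graft = Inl ` range (enumerate M)" unfolding maxima_graft singleton_cascade by auto
    then show ?thesis by (simp only: range_enumerate[OF cofinite(1)])
  qed
  have "rank graft (Inr (h 0)) = (LEAST \<alpha>. 0 < \<alpha>)" by (simp add: rank_graft_root singleton_cascade)
  also have "\<dots> = (1 :: ordinal)"
  proof (rule Least_equality)
    show "(0 :: ordinal) < 1" by (simp add: less_one_ordinal_iff)
    show "1 \<le> \<alpha>" if "0 < \<alpha>" for \<alpha> :: ordinal
      using that less_one_ordinal_iff[of \<alpha>] by (auto simp: not_less[symmetric])
  qed
  finally have rank: "rank graft (Inr (h 0)) = 1" .
  have "maxima graft \<subseteq> Field graft" by (auto simp: maxima_def)
  then have "{n. Inl n \<in> maxima graft \<and> (Inr (h 0), Inl n) \<in> graft} = M"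
    unfolding graft_root Max by auto
  then have "contour graft = cofinite_on M"
    unfolding contour_def root_graft contour_at_rank_1[OF cascade_graft root_not_maximal rank] by simp
  moreover have "Field graft \<subseteq> Inl ` M \<union> Inr ` range h"
    using cofinite(1) by (auto simp: Field_graft enumerate_in_set)
  ultimately show ?case
    using cascade_graft sequential_graft monotone_graft Max rank
    by (intro exI[of _ graft]) (simp add: cascade_rank_def root_graft)
next
  case (bind \<beta> X F)
  let ?h = "\<lambda>n m. h (Suc (prod_encode (n, m)))"
  have h: "inj (?h n)" for n by (rule injI) (auto dest!: injD[OF bind.prems])
  have "\<forall>n. \<exists>V :: (nat + nat) rel. cascade V \<and> sequential V \<and> monotone_cascade V \<and>
      maxima V = Inl ` X n \<and> Field V \<subseteq> Inl ` X n \<union> Inr ` range (?h n) \<and> 1 \<le> cascade_rank V \<and>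
      cascade_rank V = \<beta> n \<and> contour V = F n"
    using bind.IH[OF h] ..
  from choice[OF this] obtain V :: "nat \<Rightarrow> (nat + nat) rel" where
    tree: "\<And>n. cascade (V n)" "\<And>n. sequential (V n)" "\<And>n. monotone_cascade (V n)"
      "\<And>n. maxima (V n) = Inl ` X n" "\<And>n. Field (V n) \<subseteq> Inl ` X n \<union> Inr ` range (?h n)"
      "\<And>n. 1 \<le> cascade_rank (V n)" "\<And>n. cascade_rank (V n) = \<beta> n" "\<And>n. contour (V n) = F n"
    by blast
  have sep: "Field (V m) \<inter> Field (V n) = {}" if "m \<noteq> n" for m n
  proof -
    have "X m \<inter> X n = {}" using bind.hyps(3) that by (simp add: disjoint_family_on_def)
    moreover have "range (?h m) \<inter> range (?h n) = {}"
      using that by (auto dest!: injD[OF bind.prems])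
    ultimately show ?thesis using tree(5)[of m] tree(5)[of n] by blast
  qed
  have fresh: "Inr (h 0) \<notin> Field (V n)" for n
    using tree(5)[of n] by (auto dest!: injD[OF bind.prems])
  interpret grafting "Inr (h 0)" V
    by unfold_locales (use tree(1-3) sep fresh bind.hyps(2) in \<open>simp_all add: tree(7)\<close>)
  \<comment> \<open>The rank exceeds \<open>1\<close>, so the contour at the new root is the limit and not a cofinite filter.\<close>
  have rank: "cascade_rank graft = (LEAST \<alpha>. \<forall>n. \<beta> n < \<alpha>)"
    using rank_graft_root by (simp only: tree(7) cascade_rank_def[of graft] root_graft)
  have "1 \<le> cascade_rank (V 0)" by (rule tree(6))
  also have "cascade_rank (V 0) = rank graft (root (V 0))"
    by (rule rank_graft_root_V[symmetric])
  also have "\<dots> < cascade_rank graft"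
    unfolding cascade_rank_def root_graft
    by (rule rank_isucc_less[OF cascade_graft sequential_graft]) (simp add: isucc_graft_root)
  finally have pos: "1 < cascade_rank graft" .
  have "contour graft = filter_bind sequentially F"
  proof -
    have "maxima (V n) \<subseteq> range Inl" for n by (auto simp: tree(4))
    moreover have "rank graft (Inr (h 0)) \<noteq> 1" using pos by (simp add: cascade_rank_def root_graft)
    ultimately have "contour graft = filter_bind sequentially (\<lambda>n. contour (V n))" by (rule contour_graft)
    then show ?thesis by (simp only: tree(8))
  qed
  moreover have "maxima graft = Inl ` (\<Union>n. X n)" unfolding maxima_graft tree(4) by (rule image_UN[symmetric])
  moreover have "Field graft \<subseteq> Inl ` (\<Union>n. X n) \<union> Inr ` range h"
  proof -
    have "Field (V n) \<subseteq> Inl ` (\<Union>n. X n) \<union> Inr ` range h" for n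
      using tree(5) by (rule subset_trans) auto
    then show ?thesis unfolding Field_graft by blast
  qed
  ultimately show ?case
    using cascade_graft sequential_graft monotone_graft rank pos
    by (intro exI[of _ graft]) (simp add: less_imp_le)
qed

lemma monotone_sequential_contour_iff:
  "monotone_sequential_contour \<beta> F \<longleftrightarrow> (\<exists>X. contour_on \<beta> X F)"
proof
  show "\<exists>X. contour_on \<beta> X F" if "monotone_sequential_contour \<beta> F"
    using that by (rule contour_on_of_monotone_sequential_contour)
  show "monotone_sequential_contour \<beta> F" if "\<exists>X. contour_on \<beta> X F"
  proof -
    from that obtain X where "contour_on \<beta> X F" ..
    from cascade_of_contour_on[OF this, of id] show ?thesis
      unfolding monotone_sequential_contour_def by force
  qed
qed

text \<open>
  A cascade is a relation on a countable set and so can be coded by a set of natural numbers.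
\<close>

lemma contours_indexed_by_continuum:
  obtains E :: "nat set \<Rightarrow> nat filter"
  where "\<And>\<beta> X F. contour_on \<beta> X F \<Longrightarrow> F \<in> range E"
proof
  let ?E = "\<lambda>S. contour {x :: (nat + nat) \<times> (nat + nat). to_nat x \<in> S}"
  fix \<beta> X F assume "contour_on \<beta> X F"
  then obtain V :: "(nat + nat) rel" where V: "F = contour V"
    using monotone_sequential_contour_iff unfolding monotone_sequential_contour_def by blast
  have "V = {x. to_nat x \<in> to_nat ` V}" by (auto dest: injD[OF inj_to_nat])
  then have "F = ?E (to_nat ` V)" using V by simp
  then show "F \<in> range ?E" by blast
qed

section \<open>Preimages and images of contours\<close>

text \<open>
  Replace the supports of the rank one contours by their preimages.  A set that misses
  only finitely many points of such a preimage contains the preimage of a set that misses only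
  finitely many points, namely the images of the missing ones.
\<close>

lemma contour_on_pullback:
  assumes "contour_on \<alpha> X F" "surj g"
  shows "\<exists>G. contour_on \<alpha> (g -` X) G \<and> filtercomap g F \<le> G"
  using assms(1)
proof (induction rule: contour_on.induct)
  case (cofinite M)
  have "infinite (g -` M)"
    using cofinite assms(2) by (metis finite_imageI surj_image_vimage_eq)
  moreover have "filtercomap g (cofinite_on M) \<le> cofinite_on (g -` M)"
  proof (rule filter_leI)
    fix P assume "eventually P (cofinite_on (g -` M))"
    then have "finite {x \<in> g -` M. \<not> P x}" by (simp add: eventually_cofinite_on)
    then have "finite (g ` {x \<in> g -` M. \<not> P x})" by simp
    moreover have "{y \<in> M. \<not> (\<forall>x. g x = y \<longrightarrow> P x)} \<subseteq> g ` {x \<in> g -` M. \<not> P x}" by auto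
    ultimately have "eventually (\<lambda>y. \<forall>x. g x = y \<longrightarrow> P x) (cofinite_on M)"
      unfolding eventually_cofinite_on by (rule rev_finite_subset)
    then show "eventually P (filtercomap g (cofinite_on M))"
      by (auto simp: eventually_filtercomap)
  qed
  ultimately show ?case by (blast intro: contour_on.cofinite)
next
  case (bind \<beta> X F)
  then have "\<forall>n. \<exists>G. contour_on (\<beta> n) (g -` X n) G \<and> filtercomap g (F n) \<le> G" by blast
  then obtain G where G: "\<And>n. contour_on (\<beta> n) (g -` X n) (G n)"
    "\<And>n. filtercomap g (F n) \<le> G n" by metis
  have "contour_on (LEAST \<alpha>. \<forall>n. \<beta> n < \<alpha>) (\<Union>n. g -` X n) (filter_bind sequentially G)"
    using bind.hyps(3) by (intro contour_on.bind G(1) bind.hyps(2)) (auto simp: disjoint_family_on_def)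
  moreover have "filtercomap g (filter_bind sequentially F) \<le> filter_bind sequentially G"
  proof (rule filter_leI)
    fix P assume "eventually P (filter_bind sequentially G)"
    then have "\<forall>\<^sub>F n in sequentially. eventually P (G n)" by (simp add: eventually_filter_bind)
    then have "\<forall>\<^sub>F n in sequentially. eventually (\<lambda>y. \<forall>x. g x = y \<longrightarrow> P x) (F n)"
    proof eventually_elim
      case (elim n)
      then have "eventually P (filtercomap g (F n))" using G(2) by (rule filter_leD[rotated])
      then show ?case unfolding eventually_filtercomap
        by (auto elim!: eventually_mono)
    qed
    then have "eventually (\<lambda>y. \<forall>x. g x = y \<longrightarrow> P x) (filter_bind sequentially F)"
      by (simp add: eventually_filter_bind)
    then show "eventually P (filtercomap g (filter_bind sequentially F))"
      by (auto simp: eventually_filtercomap)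
  qed
  ultimately show ?case by (auto simp: vimage_UN)
qed

definition lifts :: "nat filter \<Rightarrow> (nat \<Rightarrow> nat) \<Rightarrow> nat set \<Rightarrow> nat set \<Rightarrow> bool" where
  "lifts F f S A \<longleftrightarrow> (\<exists>K\<subseteq>S. null F K \<and> f ` K = A)"

lemma lifts_subset:
  assumes "lifts F f S B" "A \<subseteq> B"
  shows "lifts F f S A"
proof -
  obtain K where K: "K \<subseteq> S" "null F K" "f ` K = B" using assms(1) by (auto simp: lifts_def)
  have "f ` (K \<inter> f -` A) = A" using K(3) assms(2) by auto
  then show ?thesis
    unfolding lifts_def using K by (intro exI[of _ "K \<inter> f -` A"]) (auto intro: null_mono)
qed

text \<open>
  The images of the null subsets of \<open>S\<close> form an ideal on \<open>f ` S\<close>.  If this ideal is proper, the second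
  alternative says that its dual filter contains a contour of rank \<open>\<alpha>\<close>.
\<close>

definition image_dichotomy :: "ordinal \<Rightarrow> nat filter \<Rightarrow> (nat \<Rightarrow> nat) \<Rightarrow> nat set \<Rightarrow> bool" where
  "image_dichotomy \<alpha> F f S \<longleftrightarrow> lifts F f S (f ` S) \<or>
    (\<exists>Y G. contour_on \<alpha> Y G \<and> Y \<subseteq> f ` S \<and> (\<forall>A\<subseteq>f ` S. null G A \<longrightarrow> lifts F f S A))"

text \<open>
  If almost all pieces \<open>C n\<close> are covered by null sets, the first case holds.  Otherwise infinitely many
  pieces carry contours; the supports of these are disjoint because the pieces are, and the limit
  of these contours has the full rank by monotonicity.
\<close>

lemma combine_dichotomies:
  assumes "mono \<beta>" "disjoint_family C" "\<And>n. image_dichotomy (\<beta> n) (F n) f (S n)"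
    and fS: "\<And>n. f ` S n = C n"
  obtains "\<forall>\<^sub>F n in sequentially. lifts (F n) f (S n) (C n)"
  | Y G where "contour_on (LEAST \<alpha>. \<forall>n. \<beta> n < \<alpha>) Y G" "Y \<subseteq> (\<Union>n. C n)"
      "\<And>A. null G A \<Longrightarrow> \<forall>\<^sub>F n in sequentially. lifts (F n) f (S n) (A \<inter> C n)"
proof (cases "finite {n. \<not> lifts (F n) f (S n) (C n)}")
  case True
  then have "\<forall>\<^sub>F n in sequentially. lifts (F n) f (S n) (C n)"
    by (simp add: cofinite_eq_sequentially[symmetric] eventually_cofinite)
  then show thesis by (rule that)
next
  case False
  let ?N = "{n. \<not> lifts (F n) f (S n) (C n)}"
  define r where "r = enumerate ?N"
  have r: "strict_mono r" "range r = ?N"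
    using False by (simp_all add: r_def strict_mono_enumerate range_enumerate)
  have "\<exists>Y G. contour_on (\<beta> (r m)) Y G \<and> Y \<subseteq> C (r m) \<and>
      (\<forall>A\<subseteq>C (r m). null G A \<longrightarrow> lifts (F (r m)) f (S (r m)) A)" for m
  proof -
    have "r m \<in> ?N" using r(2) by blast
    then show ?thesis using assms(3)[of "r m"] by (auto simp: image_dichotomy_def fS)
  qed
  then obtain Y G where YG: "\<And>m. contour_on (\<beta> (r m)) (Y m) (G m)" "\<And>m. Y m \<subseteq> C (r m)"
    "\<And>m A. A \<subseteq> C (r m) \<Longrightarrow> null (G m) A \<Longrightarrow> lifts (F (r m)) f (S (r m)) A" by metis
  have "disjoint_family Y"
    unfolding disjoint_family_on_def
  proof (intro ballI impI)
    fix m n :: nat assume "m \<noteq> n"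
    then have "r m \<noteq> r n" using r(1) by (simp add: strict_mono_eq)
    then have "C (r m) \<inter> C (r n) = {}" using assms(2) by (simp add: disjoint_family_on_def)
    then show "Y m \<inter> Y n = {}" using YG(2) by blast
  qed
  moreover have "mono (\<lambda>m. \<beta> (r m))"
    using assms(1) r(1) by (simp add: mono_def strict_mono_less_eq)
  ultimately have "contour_on (LEAST \<alpha>. \<forall>m. \<beta> (r m) < \<alpha>) (\<Union>m. Y m) (filter_bind sequentially G)"
    by (intro contour_on.bind YG(1))
  moreover have "\<forall>\<^sub>F n in sequentially. lifts (F n) f (S n) (A \<inter> C n)"
    if "null (filter_bind sequentially G) A" for A
  proof -
    have "finite {m. \<not> null (G m) A}"
      using that
      by (simp add: null_filter_bind cofinite_eq_sequentially[symmetric] eventually_cofinite)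
    then have "finite (r ` {m. \<not> null (G m) A})" by simp
    moreover have "{n. \<not> lifts (F n) f (S n) (A \<inter> C n)} \<subseteq> r ` {m. \<not> null (G m) A}"
    proof
      fix n assume n: "n \<in> {n. \<not> lifts (F n) f (S n) (A \<inter> C n)}"
      then have "n \<in> ?N" using lifts_subset by blast
      then obtain m where m: "n = r m" using r(2) by blast
      have "\<not> null (G m) (A \<inter> C n)" using n YG(3)[of "A \<inter> C n" m] m by blast
      then have "\<not> null (G m) A" using null_mono by blast
      then show "n \<in> r ` {m. \<not> null (G m) A}" using m by blast
    qed
    ultimately have "finite {n. \<not> lifts (F n) f (S n) (A \<inter> C n)}" by (rule rev_finite_subset)
    then show ?thesis by (simp add: cofinite_eq_sequentially[symmetric] eventually_cofinite)
  qed
  moreover have "(\<Union>m. Y m) \<subseteq> (\<Union>n. C n)" using YG(2) by blast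
  ultimately show thesis
    unfolding Least_bound_subseq[OF assms(1) r(1)] by (intro that(2))
qed

text \<open>
  Disjointness of the supports keeps the other pieces out of \<open>X n\<close>, so each piece can be chosen on its own.
\<close>

lemma null_bind_pieces:
  assumes "\<And>n. contour_on (\<beta> n) (X n) (F n)" "disjoint_family X"
    and "\<And>n. K n \<subseteq> X n" "\<forall>\<^sub>F n in sequentially. null (F n) (K n)" "L \<inter> (\<Union>n. X n) = {}"
  shows "null (filter_bind sequentially F) (L \<union> (\<Union>n. K n))"
  unfolding null_filter_bind using assms(4)
proof eventually_elim
  case (elim n)
  have "K m \<inter> X n \<subseteq> K n" for m
    proof (cases "m = n")
    case False
    then have "X m \<inter> X n = {}" using assms(2) by (simp add: disjoint_family_on_def)
    then show ?thesis using assms(3)[of m] by blast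
  qed blast
  then have "(L \<union> (\<Union>m. K m)) \<inter> X n \<subseteq> K n" using assms(5) by blast
  with elim have "null (F n) ((L \<union> (\<Union>m. K m)) \<inter> X n)" by (rule null_mono)
  then show ?case using null_Int_support[OF assms(1)] by (rule iffD2[rotated])
qed

text \<open>
  The images of the supports \<open>X n\<close> may overlap, so they are first made disjoint by assigning each point
  to the first image that contains it.  The induction hypothesis is then applied to
  the part \<open>T n\<close> of \<open>S \<inter> X n\<close> that is mapped to the \<open>n\<close>-th piece.
\<close>

lemma contour_image_dichotomy:
  assumes "contour_on \<alpha> X F"
  shows "image_dichotomy \<alpha> F f S"
  using assms
proof (induction arbitrary: S rule: contour_on.induct)
  case (cofinite M)
  have *: "lifts (cofinite_on M) f S A" if A: "A \<subseteq> f ` S" "finite (A \<inter> f ` (S \<inter> M))" for A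
  proof -
    obtain K where K: "K \<subseteq> S \<inter> M" "finite K" "A \<inter> f ` (S \<inter> M) = f ` K"
      using finite_subset_image[OF A(2), of f "S \<inter> M"] by blast
    have "f ` (K \<union> ((S - M) \<inter> f -` A)) = A" using A(1) K(3) by blast
    moreover have "M \<inter> (K \<union> ((S - M) \<inter> f -` A)) \<subseteq> K" by blast
    then have "null (cofinite_on M) (K \<union> ((S - M) \<inter> f -` A))"
      unfolding null_cofinite_on using K(2) by (rule finite_subset)
    ultimately show ?thesis
      unfolding lifts_def using K(1) by (intro exI[of _ "K \<union> ((S - M) \<inter> f -` A)"]) blast
  qed
  show ?case
  proof (cases "finite (f ` (S \<inter> M))")
    case True
    then show ?thesis unfolding image_dichotomy_def by (intro disjI1 *) auto
  next
    case False
    have "lifts (cofinite_on M) f S A"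
      if "A \<subseteq> f ` S" "null (cofinite_on (f ` (S \<inter> M))) A" for A
      using that unfolding null_cofinite_on by (intro *) (simp_all only: Int_commute)
    then show ?thesis
      unfolding image_dichotomy_def using False
      by (intro disjI2 exI[of _ "f ` (S \<inter> M)"] exI[of _ "cofinite_on (f ` (S \<inter> M))"])
        (auto intro: contour_on.cofinite)
  qed
next
  case (bind \<beta> X F)
  define C where "C n = f ` (S \<inter> X n) - (\<Union>i<n. f ` (S \<inter> X i))" for n
  define T where "T n = S \<inter> X n \<inter> f -` C n" for n
  have fT: "f ` T n = C n" for n by (auto simp: T_def C_def)
  have C: "disjoint_family C"
    unfolding disjoint_family_on_def
  proof (intro ballI impI)
    fix m n :: nat assume "m \<noteq> n"
    then consider "m < n" | "n < m" by linarith
    then show "C m \<inter> C n = {}" by cases (auto simp: C_def)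
  qed
  have "f ` (S \<inter> X n) \<subseteq> (\<Union>m. C m)" for n
  proof
    fix y assume y: "y \<in> f ` (S \<inter> X n)"
    define m where "m = (LEAST m. y \<in> f ` (S \<inter> X m))"
    have "y \<in> f ` (S \<inter> X m)" unfolding m_def using y by (rule LeastI)
    moreover have "y \<notin> f ` (S \<inter> X i)" if "i < m" for i
      using that not_less_Least unfolding m_def by blast
    ultimately show "y \<in> (\<Union>m. C m)" by (auto simp: C_def)
  qed
  then have fS: "f ` S \<subseteq> f ` (S - (\<Union>n. X n)) \<union> (\<Union>n. C n)" by blast
  have assemble: "lifts (filter_bind sequentially F) f S A"
    if A: "A \<subseteq> f ` S" "\<forall>\<^sub>F n in sequentially. lifts (F n) f (T n) (A \<inter> C n)" for A
  proof -
    have "\<exists>K\<subseteq>T n. f ` K = A \<inter> C n \<and> (lifts (F n) f (T n) (A \<inter> C n) \<longrightarrow> null (F n) K)" for n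
    proof (cases "lifts (F n) f (T n) (A \<inter> C n)")
      case True
      then show ?thesis by (auto simp: lifts_def)
    next
      case False
      have "f ` (T n \<inter> f -` A) = A \<inter> C n" unfolding fT[symmetric] by auto
      with False show ?thesis by blast
    qed
    then have "\<forall>n. \<exists>K\<subseteq>T n. f ` K = A \<inter> C n \<and> (lifts (F n) f (T n) (A \<inter> C n) \<longrightarrow> null (F n) K)" ..
    from choice[OF this] obtain K where K: "\<And>n. K n \<subseteq> T n" "\<And>n. f ` K n = A \<inter> C n"
      "\<And>n. lifts (F n) f (T n) (A \<inter> C n) \<Longrightarrow> null (F n) (K n)" by blast
    \<comment> \<open>Outside the supports every set is null.\<close>
    let ?L = "(S - (\<Union>n. X n)) \<inter> f -` A"
    have "null (filter_bind sequentially F) (?L \<union> (\<Union>n. K n))"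
    proof (rule null_bind_pieces[OF bind.hyps(1,3)])
      show "K n \<subseteq> X n" for n using K(1)[of n] by (auto simp: T_def)
      show "\<forall>\<^sub>F n in sequentially. null (F n) (K n)"
        using A(2) by eventually_elim (rule K(3))
    qed blast
    moreover have "f ` (?L \<union> (\<Union>n. K n)) = A"
    proof -
      have "f ` ?L = A \<inter> f ` (S - (\<Union>n. X n))" by auto
      then have "f ` (?L \<union> (\<Union>n. K n)) = A \<inter> (f ` (S - (\<Union>n. X n)) \<union> (\<Union>n. C n))"
        by (simp only: image_Un image_UN K(2) Int_Un_distrib Int_UN_distrib)
      also have "\<dots> = A" using A(1) fS by (simp only: Int_absorb2 subset_trans)
      finally show ?thesis .
    qed
    moreover have "?L \<union> (\<Union>n. K n) \<subseteq> S" using K(1) by (auto simp: T_def)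
    ultimately show ?thesis unfolding lifts_def by blast
  qed
  have "image_dichotomy (\<beta> n) (F n) f (T n)" for n by (rule bind.IH)
  from bind.hyps(2) C this fT show ?case
  proof (rule combine_dichotomies)
    assume "\<forall>\<^sub>F n in sequentially. lifts (F n) f (T n) (C n)"
    then have "lifts (filter_bind sequentially F) f S (f ` S)"
      by (intro assemble order_refl) (auto elim!: eventually_mono intro: lifts_subset)
    then show ?thesis by (simp add: image_dichotomy_def)
  next
    fix Y G
    assume YG: "contour_on (LEAST \<alpha>. \<forall>n. \<beta> n < \<alpha>) Y G" "Y \<subseteq> (\<Union>n. C n)"
      "\<And>A. null G A \<Longrightarrow> \<forall>\<^sub>F n in sequentially. lifts (F n) f (T n) (A \<inter> C n)"
    have "(\<Union>n. C n) \<subseteq> f ` S" by (auto simp: C_def)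
    with YG(2) have "Y \<subseteq> f ` S" by (rule subset_trans)
    with YG(1,3) assemble show ?thesis
      unfolding image_dichotomy_def by (intro disjI2 exI[of _ Y] exI[of _ G]) simp
  qed
qed

text \<open>
  Let \<open>B n\<close> be the image of the part of \<open>S\<close> that lies in the supports from \<open>X n\<close> on; no \<open>B n\<close> is null.
  If their intersection is not null, each of its points \<open>y\<close> is the image of a point in some support
  of index at least \<open>y\<close>, and these preimages meet each support in a finite set.  Otherwise
  the sets \<open>C n = B n - B (Suc n)\<close> are null pieces with a non-null union.  The image dichotomy on these
  pieces provides either the lift or a contour of the full rank; the latter is not contained in \<open>p\<close>,
  so some null set of it is not null for \<open>p\<close> and can be lifted instead.

  Null intersections with every support, rather than with almost every one, and null images of these
  intersections are what the covering argument in \<open>compatible_avoid_contour\<close> depends on.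
\<close>

lemma transversal_lift:
  assumes p: "ultrafilter p" "p \<le> cofinite"
      "\<And>Y G. contour_on (LEAST \<alpha>. \<forall>n. \<beta> n < \<alpha>) Y G \<Longrightarrow> \<not> p \<le> G"
    and X: "\<And>n. contour_on (\<beta> n) (X n) (F n)" "mono \<beta>" "disjoint_family X"
    and pos: "\<And>A. null (filter_bind sequentially F) (- A) \<Longrightarrow> \<not> null p (f ` (S \<inter> A))"
  shows "\<exists>K\<subseteq>S \<inter> (\<Union>n. X n). (\<forall>n. null (F n) (K \<inter> X n)) \<and> (\<forall>n. null p (f ` (K \<inter> X n))) \<and>
    \<not> null p (f ` K)"
proof -
  define T where "T n = (\<Union>j\<in>{n..}. X j)" for n
  define B where "B n = f ` (S \<inter> T n)" for n
  have "\<forall>\<^sub>F j in sequentially. null (F j) (- T n)" for n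
    using eventually_ge_at_top[of n]
  proof eventually_elim
    case (elim j)
    then have "- T n \<subseteq> - X j" by (auto simp: T_def)
    with contour_on_support[OF X(1)] show ?case by (rule null_mono)
  qed
  then have B: "\<not> null p (B n)" for n
    unfolding B_def by (intro pos) (simp add: null_filter_bind)
  have antiB: "B m \<subseteq> B n" if "n \<le> m" for m n
  proof -
    have "T m \<subseteq> T n" unfolding T_def using that by (intro UN_mono) auto
    then show ?thesis unfolding B_def by blast
  qed
  define D where "D = (\<Inter>n. B n)"
  show ?thesis
  proof (cases "null p D")
    case False
    have "\<exists>x j. x \<in> S \<and> y \<le> j \<and> x \<in> X j \<and> f x = y" if "y \<in> D" for y
    proof -
      have "y \<in> B y" using that by (simp add: D_def)
      then obtain x where "x \<in> S" "x \<in> T y" "f x = y" by (auto simp: B_def)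
      then show ?thesis by (auto simp: T_def)
    qed
    then obtain x j where xj: "\<And>y. y \<in> D \<Longrightarrow> x y \<in> S \<and> y \<le> j y \<and> x y \<in> X (j y) \<and> f (x y) = y"
      by metis
    define K where "K = x ` D"
    have KX: "finite (K \<inter> X n)" for n
    proof (rule finite_subset)
      show "K \<inter> X n \<subseteq> x ` {..n}"
      proof
        fix z assume "z \<in> K \<inter> X n"
        then obtain y where y: "y \<in> D" "z = x y" "x y \<in> X n" by (auto simp: K_def)
        then have "x y \<in> X (j y)" using xj by blast
        then have "j y = n" using y(3) X(3) by (auto simp: disjoint_family_on_def)
        then show "z \<in> x ` {..n}" using xj[OF y(1)] y(2) by auto
      qed
    qed simp
    have "f ` K = D" using xj by (force simp: K_def)
    then have "\<not> null p (f ` K)" using False by simp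
    moreover have "null (F n) (K \<inter> X n)" for n
      using contour_on_free[OF X(1) KX] .
    moreover have "null p (f ` (K \<inter> X n))" for n
      by (rule null_finite[OF p(2)]) (simp add: KX)
    moreover have "K \<subseteq> S \<inter> (\<Union>n. X n)" using xj by (auto simp: K_def)
    ultimately show ?thesis by blast
  next
    case True
    define C where "C n = B n - B (Suc n)" for n
    \<comment> \<open>The part of the \<open>n\<close>-th support that accounts for \<open>C n\<close>, which misses \<open>B (Suc n)\<close>.\<close>
    define R where "R n = S \<inter> X n \<inter> f -` C n" for n
    have "T n \<subseteq> X n \<union> T (Suc n)" for n
      by (auto simp: T_def) (metis Suc_leI atLeast_iff le_neq_implies_less)
    then have "C n \<subseteq> f ` (S \<inter> X n)" for n unfolding C_def B_def by blast
    then have fR: "f ` R n = C n" for n unfolding R_def by blast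
    have disjC: "disjoint_family C"
      unfolding disjoint_family_on_def
    proof (intro ballI impI)
      fix m n :: nat assume "m \<noteq> n"
      then consider "Suc m \<le> n" | "Suc n \<le> m" by linarith
      then show "C m \<inter> C n = {}"
      proof cases
        case 1
        then show ?thesis using antiB[OF 1] by (auto simp: C_def)
      next
        case 2
        then show ?thesis using antiB[OF 2] by (auto simp: C_def)
      qed
    qed
    have nullC: "null p (C n)" for n
      using B[of "Suc n"] unfolding not_null_ultrafilter[OF p(1)]
      by (rule null_mono) (auto simp: C_def)
    have "y \<in> D \<union> (\<Union>n. C n)" if "y \<in> B 0" for y
    proof (rule ccontr)
      assume y: "y \<notin> D \<union> (\<Union>n. C n)"
      have "y \<in> B n" for n by (induction n) (use that y in \<open>auto simp: C_def\<close>)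
      then show False using y by (simp add: D_def)
    qed
    then have posC: "\<not> null p (\<Union>n. C n)"
      using B[of 0] True by (metis null_Un_iff null_mono subsetI)
    obtain A where A: "A \<subseteq> (\<Union>n. C n)" "\<not> null p A"
      "\<forall>\<^sub>F n in sequentially. lifts (F n) f (R n) (A \<inter> C n)"
    proof (rule combine_dichotomies[OF X(2) disjC contour_image_dichotomy[OF X(1)] fR])
      assume "\<forall>\<^sub>F n in sequentially. lifts (F n) f (R n) (C n)"
      then have "\<forall>\<^sub>F n in sequentially. lifts (F n) f (R n) ((\<Union>n. C n) \<inter> C n)"
        by eventually_elim (rule lifts_subset, auto)
      with posC show thesis by (intro that) auto
    next
      fix Y G assume G: "contour_on (LEAST \<alpha>. \<forall>n. \<beta> n < \<alpha>) Y G"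
        "\<And>A. null G A \<Longrightarrow> \<forall>\<^sub>F n in sequentially. lifts (F n) f (R n) (A \<inter> C n)"
      from p(3)[OF G(1)] obtain P where P: "eventually P G" "\<not> eventually P p"
        by (auto simp: le_filter_def)
      let ?A = "{x. \<not> P x} \<inter> (\<Union>n. C n)"
      have "null G {x. \<not> P x}" using P(1) by (simp add: null_def)
      then have "null G ?A" by (rule null_mono) blast
      moreover have "\<not> null p ?A"
      proof
        assume "null p ?A"
        then have "null p (?A \<union> - (\<Union>n. C n))"
          using posC unfolding not_null_ultrafilter[OF p(1)] by (simp only: null_Un_iff)
        then have "null p {x. \<not> P x}" by (rule null_mono) blast
        with P(2) show False by (simp add: null_def)
      qed
      ultimately show thesis by (intro that[of ?A] G(2)) auto
    qed
    then obtain N where "\<And>n. n \<ge> N \<Longrightarrow> lifts (F n) f (R n) (A \<inter> C n)"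
      by (auto simp: eventually_sequentially)
    then have "\<forall>n\<in>{N..}. \<exists>K. K \<subseteq> R n \<and> null (F n) K \<and> f ` K = A \<inter> C n"
      unfolding lifts_def by simp
    from bchoice[OF this] obtain K where K: "n \<ge> N \<Longrightarrow> K n \<subseteq> R n"
      "n \<ge> N \<Longrightarrow> null (F n) (K n)" "n \<ge> N \<Longrightarrow> f ` K n = A \<inter> C n" for n by auto
    \<comment> \<open>The finitely many pieces before \<open>N\<close>, where \<open>K\<close> need not be null, have null images.\<close>
    define L where "L = (\<Union>n\<in>{N..}. K n)"
    have LX: "L \<inter> X n = (if n \<ge> N then K n else {})" for n
    proof -
      have "K m \<inter> X n = (if m = n then K n else {})" if "m \<ge> N" for m
      proof (cases "m = n")
        case True
        then show ?thesis using K(1)[OF that] by (auto simp: R_def)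
      next
        case False
        then have "X m \<inter> X n = {}" using X(3) by (simp add: disjoint_family_on_def)
        then show ?thesis using False K(1)[OF that] by (auto simp: R_def)
      qed
      moreover have "L \<inter> X n = (\<Union>m\<in>{N..}. K m \<inter> X n)" by (auto simp: L_def)
      ultimately show ?thesis by (auto split: if_splits)
    qed
    have fL: "f ` L = (\<Union>n\<in>{N..}. A \<inter> C n)" using K(3) by (auto simp: L_def image_UN)
    have "\<not> null p (f ` L)"
    proof
      assume "null p (f ` L)"
      moreover have "null p (\<Union>n\<in>{..<N}. C n)" by (rule null_UN_finite) (simp_all add: nullC)
      ultimately have "null p (f ` L \<union> (\<Union>n\<in>{..<N}. C n))" by (simp only: null_Un_iff)
      moreover have "A \<subseteq> f ` L \<union> (\<Union>n\<in>{..<N}. C n)"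
      proof
        fix y assume y: "y \<in> A"
        then obtain n where "y \<in> C n" using A(1) by blast
        with y show "y \<in> f ` L \<union> (\<Union>n\<in>{..<N}. C n)"
          unfolding fL by (cases "n < N") auto
      qed
      ultimately show False using A(2) null_mono by blast
    qed
    moreover have "null (F n) (L \<inter> X n)" for n
      using K(2) by (simp add: LX) (simp add: null_def)
    moreover have "null p (f ` (L \<inter> X n))" for n
    proof (rule null_mono[OF nullC])
      show "f ` (L \<inter> X n) \<subseteq> C n" using K(3)[of n] by (simp add: LX)
    qed
    moreover have "L \<subseteq> S \<inter> (\<Union>n. X n)" using K(1) by (fastforce simp: L_def R_def)
    ultimately show ?thesis by blast
  qed
qed

section \<open>Bases of null sets and the bounding number\<close>

text \<open>
  For a limit of contours, the value at \<open>0\<close> bounds the indices of the exceptional pieces, and the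
  remaining values code one function for each of the pieces.
\<close>

lemma contour_null_base:
  assumes "contour_on \<alpha> X F"
  shows "\<exists>\<Phi> :: (nat \<Rightarrow> nat) \<Rightarrow> nat set.
    (\<forall>\<phi>. null F (\<Phi> \<phi>)) \<and> mono \<Phi> \<and> (\<forall>K. null F K \<longrightarrow> (\<exists>\<phi>. K \<subseteq> \<Phi> \<phi>))"
  using assms
proof (induction rule: contour_on.induct)
  case (cofinite M)
  let ?\<Phi> = "\<lambda>\<phi> :: nat \<Rightarrow> nat. {..\<phi> 0} \<union> - M"
  have "null (cofinite_on M) (?\<Phi> \<phi>)" for \<phi>
    by (simp add: null_cofinite_on Int_Un_distrib)
  moreover have "mono ?\<Phi>"
    by (rule monoI) (auto simp: le_fun_def intro: order_trans)
  moreover have "\<exists>\<phi>. K \<subseteq> ?\<Phi> \<phi>" if "null (cofinite_on M) K" for K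
  proof -
    have "finite (M \<inter> K)" using that by (simp add: null_cofinite_on)
    then obtain b where "M \<inter> K \<subseteq> {..b}" by (auto simp: finite_nat_iff_bounded_le)
    then have "K \<subseteq> ?\<Phi> (\<lambda>_. b)" by auto
    then show ?thesis by (intro exI[of _ "\<lambda>_. b"]) simp
  qed
  ultimately show ?case by (intro exI[of _ ?\<Phi>]) simp
next
  case (bind \<beta> X F)
  have "\<forall>n. \<exists>\<Phi> :: (nat \<Rightarrow> nat) \<Rightarrow> nat set.
    (\<forall>\<phi>. null (F n) (\<Phi> \<phi>)) \<and> mono \<Phi> \<and> (\<forall>K. null (F n) K \<longrightarrow> (\<exists>\<phi>. K \<subseteq> \<Phi> \<phi>))" using bind.IH ..
  from choice[OF this] obtain \<Psi> :: "nat \<Rightarrow> (nat \<Rightarrow> nat) \<Rightarrow> nat set"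
    where \<Psi>: "\<And>n \<phi>. null (F n) (\<Psi> n \<phi>)" "\<And>n. mono (\<Psi> n)"
      "\<And>n K. null (F n) K \<Longrightarrow> \<exists>\<phi>. K \<subseteq> \<Psi> n \<phi>" by blast
  let ?s = "\<lambda>(\<phi> :: nat \<Rightarrow> nat) n m. \<phi> (Suc (prod_encode (n, m)))"
  let ?K = "\<lambda>\<phi> n. (if n < \<phi> 0 then X n else {}) \<union> \<Psi> n (?s \<phi> n) \<inter> X n"
  let ?\<Phi> = "\<lambda>\<phi>. - (\<Union>n. X n) \<union> (\<Union>n. ?K \<phi> n)"
  have "null (filter_bind sequentially F) (?\<Phi> \<phi>)" for \<phi>
  proof (rule null_bind_pieces[OF bind.hyps(1,3)])
    show "?K \<phi> n \<subseteq> X n" for n by auto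
    show "\<forall>\<^sub>F n in sequentially. null (F n) (?K \<phi> n)"
      using eventually_ge_at_top[of "\<phi> 0"]
    proof eventually_elim
      case (elim n)
      have "null (F n) (\<Psi> n (?s \<phi> n) \<inter> X n)" by (rule null_mono[OF \<Psi>(1)]) blast
      with elim show ?case by simp
    qed
  qed blast
  moreover have "mono ?\<Phi>"
  proof (rule monoI)
    fix \<phi> \<psi> :: "nat \<Rightarrow> nat" assume le: "\<phi> \<le> \<psi>"
    have "\<Psi> n (?s \<phi> n) \<subseteq> \<Psi> n (?s \<psi> n)" for n
      using le by (intro monoD[OF \<Psi>(2)]) (simp add: le_fun_def)
    moreover have "\<phi> 0 \<le> \<psi> 0" using le by (simp add: le_fun_def)
    ultimately have "?K \<phi> n \<subseteq> ?K \<psi> n" for n by (intro Un_mono Int_mono) auto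
    then show "?\<Phi> \<phi> \<subseteq> ?\<Phi> \<psi>" by (rule Un_mono[OF order_refl UN_mono[OF order_refl]])
  qed
  moreover have "\<exists>\<phi>. K \<subseteq> ?\<Phi> \<phi>" if K: "null (filter_bind sequentially F) K" for K
  proof -
    obtain N where N: "\<And>n. n \<ge> N \<Longrightarrow> null (F n) K"
      using K by (auto simp: null_filter_bind eventually_sequentially)
    then have "\<exists>\<psi>. n \<ge> N \<longrightarrow> K \<subseteq> \<Psi> n \<psi>" for n using \<Psi>(3) by blast
    then obtain \<psi> where \<psi>: "\<And>n. n \<ge> N \<Longrightarrow> K \<subseteq> \<Psi> n (\<psi> n)" by metis
    define \<phi> where "\<phi> k = (case k of 0 \<Rightarrow> N | Suc l \<Rightarrow> case_prod \<psi> (prod_decode l))" for k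
    have s: "?s \<phi> n = \<psi> n" for n by (simp add: \<phi>_def)
    have 0: "\<phi> 0 = N" by (simp add: \<phi>_def)
    have "K \<inter> X n \<subseteq> ?K \<phi> n" for n
      unfolding s 0 using \<psi>[of n] by (cases "n < N") auto
    then have "K \<subseteq> ?\<Phi> \<phi>" by blast
    then show ?thesis by (intro exI[of _ \<phi>])
  qed
  ultimately show ?case by (intro exI[of _ ?\<Phi>]) blast
qed

lemma dominating_function:
  assumes "|I| <o \<bb>"
  shows "\<exists>g. \<forall>i\<in>I. \<forall>\<^sub>F n in sequentially. (h i n :: nat) \<le> g n"
proof -
  have "|h ` I| <o \<bb>" using card_of_image assms by (rule ordLeq_ordLess_trans)
  then have "\<not> \<bb> \<le>o |h ` I|" using not_ordLess_ordLeq by blast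
  then have "\<not> unbounded_family (h ` I)" using bounding_number_props by blast
  then show ?thesis by (simp add: unbounded_family_def)
qed

text \<open>
  Code the functions that describe the pieces \<open>K i \<inter> X n\<close> into one function for each \<open>i\<close>.  A function that
  dominates all of them is exceeded by each at finitely many arguments only, and these belong
  to finitely many \<open>n\<close>.
\<close>

lemma common_null_cover:
  assumes "\<And>n. contour_on (\<beta> n) (X n) (F n)" "disjoint_family X" "|I| <o \<bb>"
    and K: "\<And>i n. i \<in> I \<Longrightarrow> null (F n) (K i \<inter> X n)"
  shows "\<exists>L. null (filter_bind sequentially F) L \<and>
    (\<forall>i\<in>I. \<forall>\<^sub>F n in sequentially. K i \<inter> X n \<subseteq> L)"
proof -
  have "\<forall>n. \<exists>\<Phi> :: (nat \<Rightarrow> nat) \<Rightarrow> nat set.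
    (\<forall>\<phi>. null (F n) (\<Phi> \<phi>)) \<and> mono \<Phi> \<and> (\<forall>K. null (F n) K \<longrightarrow> (\<exists>\<phi>. K \<subseteq> \<Phi> \<phi>))"
    using contour_null_base[OF assms(1)] ..
  from choice[OF this] obtain \<Psi> :: "nat \<Rightarrow> (nat \<Rightarrow> nat) \<Rightarrow> nat set"
    where \<Psi>: "\<And>n \<phi>. null (F n) (\<Psi> n \<phi>)" "\<And>n. mono (\<Psi> n)"
      "\<And>n K. null (F n) K \<Longrightarrow> \<exists>\<phi>. K \<subseteq> \<Psi> n \<phi>" by blast
  have "\<exists>\<psi>. i \<in> I \<longrightarrow> K i \<inter> X n \<subseteq> \<Psi> n \<psi>" for i n using K \<Psi>(3) by blast
  then obtain \<psi> where \<psi>: "\<And>i n. i \<in> I \<Longrightarrow> K i \<inter> X n \<subseteq> \<Psi> n (\<psi> i n)" by metis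
  obtain g where g: "\<And>i. i \<in> I \<Longrightarrow>
      \<forall>\<^sub>F k in sequentially. case_prod (\<psi> i) (prod_decode k) \<le> g k"
    using dominating_function[OF assms(3), of "\<lambda>i k. case_prod (\<psi> i) (prod_decode k)"] by blast
  define \<gamma> where "\<gamma> n = (\<lambda>m. g (prod_encode (n, m)))" for n
  define L where "L = (\<Union>n. \<Psi> n (\<gamma> n) \<inter> X n)"
  have "null (filter_bind sequentially F) ({} \<union> L)"
    unfolding L_def
  proof (rule null_bind_pieces[OF assms(1,2)])
    have "null (F n) (\<Psi> n (\<gamma> n) \<inter> X n)" for n by (rule null_mono[OF \<Psi>(1)]) blast
    then show "\<forall>\<^sub>F n in sequentially. null (F n) (\<Psi> n (\<gamma> n) \<inter> X n)" by simp
  qed auto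
  moreover have "\<forall>\<^sub>F n in sequentially. K i \<inter> X n \<subseteq> L" if i: "i \<in> I" for i
  proof -
    let ?E = "{k. \<not> case_prod (\<psi> i) (prod_decode k) \<le> g k}"
    have "finite ((fst \<circ> prod_decode) ` ?E)"
      using g[OF i] by (simp add: cofinite_eq_sequentially[symmetric] eventually_cofinite)
    moreover have "{n. \<not> K i \<inter> X n \<subseteq> L} \<subseteq> (fst \<circ> prod_decode) ` ?E"
    proof (rule subsetI, rule ccontr)
      fix n assume "n \<in> {n. \<not> K i \<inter> X n \<subseteq> L}"
      then have n: "\<not> K i \<inter> X n \<subseteq> L" by simp
      assume notin: "n \<notin> (fst \<circ> prod_decode) ` ?E"
      have "\<psi> i n m \<le> \<gamma> n m" for m
      proof (rule ccontr)
        assume "\<not> ?thesis"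
        then have "prod_encode (n, m) \<in> ?E" by (simp add: \<gamma>_def)
        then have "(fst \<circ> prod_decode) (prod_encode (n, m)) \<in> (fst \<circ> prod_decode) ` ?E"
          by (rule imageI)
        with notin show False by simp
      qed
      then have "\<Psi> n (\<psi> i n) \<subseteq> \<Psi> n (\<gamma> n)"
        by (intro monoD[OF \<Psi>(2)]) (simp add: le_fun_def)
      then show False using n \<psi>[OF i, of n] by (auto simp: L_def)
    qed
    ultimately have "finite {n. \<not> K i \<inter> X n \<subseteq> L}" by (rule rev_finite_subset)
    then show ?thesis by (simp add: cofinite_eq_sequentially[symmetric] eventually_cofinite)
  qed
  ultimately show ?thesis by auto
qed

section \<open>Families of finite character\<close>

lemma card_of_Fpow_le:
  assumes "infinite Z"
  shows "|Fpow Z| \<le>o |Z|"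
proof -
  have inf: "infinite (Field |Z| )" using assms by (simp add: Field_card_of)
  define P where "P n = {A. A \<subseteq> Z \<and> finite A \<and> card A = n}" for n
  have P: "|P n| \<le>o |Z|" for n
  proof (induction n)
    case 0
    have "P 0 = {{}}" by (auto simp: P_def)
    moreover have "Z \<noteq> {}" using assms by auto
    ultimately show ?case by (simp add: card_of_singl_ordLeq)
  next
    case (Suc n)
    have "P (Suc n) \<subseteq> (\<lambda>(a, A). insert a A) ` (Z \<times> P n)"
    proof
      fix A assume "A \<in> P (Suc n)"
      then have A: "A \<subseteq> Z" "finite A" "card A = Suc n" by (auto simp: P_def)
      then obtain a B where "A = insert a B" "a \<notin> B" "card B = n" "finite B"
        by (metis card_Suc_eq finite_insert)
      with A show "A \<in> (\<lambda>(a, A). insert a A) ` (Z \<times> P n)"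
        by (intro image_eqI[of _ _ "(a, B)"]) (auto simp: P_def)
    qed
    then have "|P (Suc n)| \<le>o |Z \<times> P n|" using surj_imp_ordLeq by blast
    also have "|Z \<times> P n| \<le>o |Z|"
      by (rule card_of_Times_ordLeq_infinite_Field[OF inf]) (simp_all add: Suc card_of_Card_order card_of_mono1)
    finally show ?case .
  qed
  have "Fpow Z = (\<Union>n. P n)" by (auto simp: Fpow_def P_def)
  moreover have "|\<Union>n. P n| \<le>o |Z|"
    by (rule card_of_UNION_ordLeq_infinite[OF assms])
      (use assms P infinite_iff_card_of_nat in auto)
  ultimately show ?thesis by simp
qed

lemma card_of_nat_times_Fpow_less:
  assumes "natLeq <o r" "|Z| <o r"
  shows "|(UNIV :: nat set) \<times> Fpow Z| <o r"
proof (cases "finite Z")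
  case True
  then have "finite (Fpow Z)" by (auto simp: Fpow_def)
  then have "countable ((UNIV :: nat set) \<times> Fpow Z)" by (simp add: countable_finite)
  then have "|(UNIV :: nat set) \<times> Fpow Z| \<le>o natLeq" by (simp add: countable_card_le_natLeq)
  then show ?thesis using assms(1) by (rule ordLeq_ordLess_trans)
next
  case False
  have "|(UNIV :: nat set) \<times> Fpow Z| \<le>o |Z|"
  proof (rule card_of_Times_ordLeq_infinite_Field)
    show "infinite (Field |Z| )" using False by (simp add: Field_card_of)
    show "|UNIV :: nat set| \<le>o |Z|" using infinite_iff_card_of_nat False by (rule iffD1)
  qed (rule card_of_Fpow_le[OF False] card_of_Card_order)+
  then show ?thesis using assms(2) by (rule ordLeq_ordLess_trans)
qed

text \<open>
  Well-order the index type in the order type of its cardinality and choose recursively.  Before each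
  step fewer elements than indices have been chosen, and finite character carries \<open>P\<close> through
  limits, since a finite subset of what has been chosen was complete at an earlier index.
\<close>

lemma transfinite_extension:
  fixes P :: "'b set \<Rightarrow> bool" and Q :: "'a \<Rightarrow> 'b \<Rightarrow> bool"
  assumes char: "\<And>Z. P Z \<longleftrightarrow> (\<forall>Z'\<subseteq>Z. finite Z' \<longrightarrow> P Z')" and "P {}"
    and step: "\<And>Z v. P Z \<Longrightarrow> |Z| <o |UNIV :: 'a set| \<Longrightarrow> \<exists>L. P (insert L Z) \<and> Q v L"
  shows "\<exists>Z. P Z \<and> (\<forall>v. \<exists>L\<in>Z. Q v L)"
proof -
  define r where "r = |UNIV :: 'a set|"
  have r: "Card_order r" "Well_order r" "Field r = UNIV" 
    unfolding r_def by (rule card_of_Card_order card_of_Well_order Field_card_of)+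
  have rW: "wo_rel r" using r(2) by (simp add: wo_rel_def)
  have wf: "wf (r - Id)" using r(2) by (simp add: well_order_on_def)
  have total: "(v, w) \<in> r \<or> (w, v) \<in> r" for v w
    using wo_rel.TOTALS[OF rW] r(3) by auto
  have trans: "trans r" using wo_rel.TRANS[OF rW] .
  have refl: "(v, v) \<in> r" for v using total[of v v] by simp
  define \<kappa> where "\<kappa> = wfrec (r - Id)
    (\<lambda>\<kappa> v. SOME L. P (insert L (\<kappa> ` underS r v)) \<and> Q v L)"
  have \<kappa>: "\<kappa> v = (SOME L. P (insert L (\<kappa> ` underS r v)) \<and> Q v L)" for v
  proof -
    have "cut \<kappa> (r - Id) v ` underS r v = \<kappa> ` underS r v"
      by (rule image_cong) (auto simp: cut_def underS_def)
    then show ?thesis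
      using def_wfrec[OF \<kappa>_def[THEN eq_reflection] wf, of v] by simp
  qed
  have fin: "P (\<kappa> ` U)" if U: "\<And>w. w \<in> U \<Longrightarrow> P (\<kappa> ` under r w)" for U
  proof (subst char, intro allI impI)
    fix Z' assume Z': "Z' \<subseteq> \<kappa> ` U" "finite Z'"
    then obtain W where W: "W \<subseteq> U" "finite W" "Z' = \<kappa> ` W"
      using finite_subset_image[of Z' \<kappa> U] by blast
    have "W = {} \<or> (\<exists>w\<in>W. W \<subseteq> under r w)"
      using W(2)
    proof induction
      case (insert x W)
      show ?case
      proof (cases "W = {}")
        case True
        then show ?thesis using refl by (auto simp: under_def)
      next
        case False
        then obtain w where w: "w \<in> W" "W \<subseteq> under r w" using insert.IH by blast
        show ?thesis
        proof (cases "(x, w) \<in> r")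
          case True
          then show ?thesis using w by (auto simp: under_def)
        next
          case False
          then have "(w, x) \<in> r" using total by blast
          then have "W \<subseteq> under r x" using w(2) trans unfolding under_def trans_def by blast
          then show ?thesis using refl by (auto simp: under_def)
        qed
      qed
    qed simp
    then show "P Z'"
    proof
      assume "W = {}"
      then show ?thesis using W(3) \<open>P {}\<close> by simp
    next
      assume "\<exists>w\<in>W. W \<subseteq> under r w"
      then obtain w where w: "w \<in> U" "W \<subseteq> under r w" using W(1) by blast
      from U[OF w(1)] w(2) Z'(2) W(3) show ?thesis using char[of "\<kappa> ` under r w"] by blast
    qed
  qed
  have main: "P (\<kappa> ` under r v) \<and> Q v (\<kappa> v)" for v
  proof (induction v rule: wf_induct_rule[OF wf])
    case (1 v)
    have "P (\<kappa> ` underS r v)"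
      by (rule fin) (use 1 in \<open>auto simp: underS_def\<close>)
    moreover have "|underS r v| <o |UNIV :: 'a set|"
      using card_of_underS[OF r(1), of v] r(3) by (simp add: r_def)
    then have "|\<kappa> ` underS r v| <o |UNIV :: 'a set|"
      using card_of_image by (rule ordLeq_ordLess_trans[rotated])
    ultimately have "\<exists>L. P (insert L (\<kappa> ` underS r v)) \<and> Q v L" by (rule step)
    then have "P (insert (\<kappa> v) (\<kappa> ` underS r v)) \<and> Q v (\<kappa> v)"
      unfolding \<kappa>[of v] by (rule someI_ex)
    moreover have "insert (\<kappa> v) (\<kappa> ` underS r v) = \<kappa> ` under r v"
      using refl by (auto simp: under_def underS_def)
    ultimately show ?case by simp
  qed
  have "P (\<kappa> ` UNIV)" by (rule fin) (use main in blast)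
  then show ?thesis using main by blast
qed

text \<open>
  The Teichmueller-Tukey lemma.
\<close>

lemma maximal_of_finite_character:
  assumes char: "\<And>Z. P Z \<longleftrightarrow> (\<forall>Z'\<subseteq>Z. finite Z' \<longrightarrow> P Z')" and "P Z"
  obtains U where "P U" "Z \<subseteq> U" "\<And>a. P (insert a U) \<Longrightarrow> a \<in> U"
proof -
  have "\<exists>M\<in>{M. P (Z \<union> M)}. \<forall>X\<in>{M. P (Z \<union> M)}. M \<subseteq> X \<longrightarrow> X = M"
  proof (rule subset_Zorn')
    fix C assume C: "subset.chain {M. P (Z \<union> M)} C"
    have "P (Z \<union> \<Union>C)"
    proof (subst char, intro allI impI)
      fix W assume W: "W \<subseteq> Z \<union> \<Union>C" "finite W"
      show "P W"
      proof (cases "C = {}")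
        case True
        then show ?thesis using W assms(2) char[of Z] by auto
      next
        case False
        have "finite (W \<inter> \<Union>C)" "W \<inter> \<Union>C \<subseteq> \<Union>C" using W(2) by auto
        from finite_subset_Union_chain[OF this False C] obtain M where M: "M \<in> C" "W \<inter> \<Union>C \<subseteq> M" .
        have "P (Z \<union> M)" using C M(1) by (auto simp: subset.chain_def)
        moreover have "W \<subseteq> Z \<union> M" using W(1) M(2) by blast
        ultimately show ?thesis using W(2) char[of "Z \<union> M"] by blast
      qed
    qed
    then show "\<Union>C \<in> {M. P (Z \<union> M)}" by simp
  qed
  then obtain M where M: "P (Z \<union> M)" "\<And>X. P (Z \<union> X) \<Longrightarrow> M \<subseteq> X \<Longrightarrow> X = M" by blast
  show thesis
  proof (rule that[OF M(1)])
    show "a \<in> Z \<union> M" if "P (insert a (Z \<union> M))" for a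
      using M(2)[of "insert a M"] that by auto
  qed blast
qed

section \<open>Towers of ultrafilters\<close>

text \<open>
  Either the even or the odd numbers are null for \<open>u\<close>, so the map can be redefined there to hit everything.
\<close>

lemma rk_ge_surj:
  assumes "ultrafilter u" "u \<ge>RK v"
  obtains g :: "nat \<Rightarrow> nat" where "surj g" "filtermap g u = v"
proof -
  obtain f :: "nat \<Rightarrow> nat" where f: "filtermap f u = v"
    using assms(2) by (auto simp: rk_ge_def)
  obtain h :: "nat \<Rightarrow> nat" and A where A: "h ` A = UNIV" "null u A"
  proof (cases "null u (Collect even)")
    case True
    have "y \<in> (\<lambda>n. n div 2) ` Collect even" for y :: nat
      by (rule image_eqI[of _ _ "2 * y"]) simp_all
    then have "(\<lambda>n. n div 2) ` Collect even = (UNIV :: nat set)" by blast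
    then show thesis using True by (rule that)
  next
    case False
    have "y \<in> (\<lambda>n. n div 2) ` (- Collect even)" for y :: nat
      by (rule image_eqI[of _ _ "2 * y + 1"]) simp_all
    then have "(\<lambda>n. n div 2) ` (- Collect even) = (UNIV :: nat set)" by blast
    moreover have "null u (- Collect even)" using False not_null_ultrafilter[OF assms(1)] by blast
    ultimately show thesis by (rule that)
  qed
  define g where "g n = (if n \<in> A then h n else f n)" for n
  have "h ` A \<subseteq> range g" by (auto simp: g_def)
  with A(1) have "surj g" by auto
  moreover have "filtermap g u = filtermap f u"
  proof -
    have "\<forall>\<^sub>F n in u. g n = f n"
      using A(2) unfolding null_def by eventually_elim (simp add: g_def)
    then have "\<forall>\<^sub>F n in u. P (g n) \<longleftrightarrow> P (f n)" for P by eventually_elim simp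
    then show ?thesis unfolding filter_eq_iff eventually_filtermap
      by (intro allI eventually_subst)
  qed
  ultimately show thesis using f by (intro that) simp_all
qed

text \<open>
  The pair \<open>(k, y)\<close> stands for a thread through \<open>y\<close> at level \<open>k\<close>, which is continued downwards
  by the maps \<open>\<pi> j\<close> and upwards by right inverses of them.
\<close>

lemma surjective_tower:
  fixes \<pi> :: "nat \<Rightarrow> nat \<Rightarrow> nat"
  assumes "\<And>k. surj (\<pi> k)"
  shows "\<exists>g :: nat \<Rightarrow> nat \<Rightarrow> nat. \<forall>k. surj (g k) \<and> g k = \<pi> k \<circ> g (Suc k)"
proof -
  define s where "s k = inv (\<pi> k)" for k
  have s: "\<pi> k (s k y) = y" for k y unfolding s_def by (rule surj_f_inv_f[OF assms])
  define up where "up k d y = rec_nat y (\<lambda>d z. s (k + d) z) d" for k d y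
  define down where "down d = rec_nat (\<lambda>j y. y) (\<lambda>d z j y. \<pi> j (z (Suc j) y)) d" for d
  have up: "up k 0 y = y" "up k (Suc d) y = s (k + d) (up k d y)" for k d y
    by (simp_all add: up_def)
  have down: "down 0 j y = y" "down (Suc d) j y = \<pi> j (down d (Suc j) y)" for d j y
    by (simp_all add: down_def)
  define t where "t j k y = (if j \<le> k then down (k - j) j y else up k (j - k) y)" for j k y
  have t: "t j k y = \<pi> j (t (Suc j) k y)" for j k y
  proof -
    consider "Suc j \<le> k" | "j = k" | d where "j = Suc (k + d)"
      by (metis not_less_eq_eq le_antisym less_iff_Suc_add not_less)
    then show ?thesis
    proof cases
      case 1
      then have "k - j = Suc (k - Suc j)" by simp
      with 1 show ?thesis by (simp add: t_def down)
    next
      case 2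
      then show ?thesis by (simp add: t_def down up s)
    next
      case 3
      then have "Suc j - k = Suc (Suc d)" "j - k = Suc d" "k + Suc d = j" by simp_all
      with 3 show ?thesis by (simp add: t_def up s)
    qed
  qed
  define g where "g j x = case_prod (t j) (prod_decode x)" for j x
  have "surj (g k) \<and> g k = \<pi> k \<circ> g (Suc k)" for k
  proof
    show "surj (g k)"
      by (rule surjI[of _ "\<lambda>y. prod_encode (k, y)"]) (simp add: g_def t_def down)
    show "g k = \<pi> k \<circ> g (Suc k)"
      by (rule ext) (simp add: g_def t[of k] split: prod.split)
  qed
  then show ?thesis by blast
qed

locale ultrafilter_tower =
  fixes p :: "nat \<Rightarrow> nat filter" and g \<pi> :: "nat \<Rightarrow> nat \<Rightarrow> nat"
  assumes ultra: "\<And>k. ultrafilter (p k)"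
    and bond: "\<And>k. filtermap (\<pi> k) (p (Suc k)) = p k"
    and surj: "\<And>k. surj (g k)"
    and commute: "\<And>k. g k = \<pi> k \<circ> g (Suc k)"
begin

definition compatible :: "nat set set \<Rightarrow> bool" where
  "compatible Z \<longleftrightarrow> (\<forall>k. \<forall>Z'\<subseteq>Z. finite Z' \<longrightarrow> \<not> null (p k) (g k ` \<Inter>Z'))"

lemma compatible_finite_character:
  "compatible Z \<longleftrightarrow> (\<forall>Z'\<subseteq>Z. finite Z' \<longrightarrow> compatible Z')"
  unfolding compatible_def by (meson order_refl subset_trans finite_subset)

lemma compatible_empty: "compatible {}"
  using ultra by (simp add: compatible_def surj null_def ultrafilter_def eventually_False)

lemma compatibleD: "compatible Z \<Longrightarrow> Z' \<subseteq> Z \<Longrightarrow> finite Z' \<Longrightarrow> \<not> null (p k) (g k ` \<Inter>Z')"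
  by (simp add: compatible_def)

lemma compatible_insert_iff:
  "compatible (insert A Z) \<longleftrightarrow> (\<forall>k. \<forall>Z'\<subseteq>Z. finite Z' \<longrightarrow> \<not> null (p k) (g k ` (\<Inter>Z' \<inter> A)))"
proof
  assume *: "compatible (insert A Z)"
  show "\<forall>k. \<forall>Z'\<subseteq>Z. finite Z' \<longrightarrow> \<not> null (p k) (g k ` (\<Inter>Z' \<inter> A))"
  proof (intro allI impI)
    fix k Z' assume "Z' \<subseteq> Z" "finite Z'"
    then show "\<not> null (p k) (g k ` (\<Inter>Z' \<inter> A))"
      using compatibleD[OF *, of "insert A Z'" k] by (auto simp: Int_commute)
  qed
next
  assume *: "\<forall>k. \<forall>Z'\<subseteq>Z. finite Z' \<longrightarrow> \<not> null (p k) (g k ` (\<Inter>Z' \<inter> A))"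
  show "compatible (insert A Z)"
    unfolding compatible_def
  proof (intro allI impI)
    fix k Z' assume Z': "Z' \<subseteq> insert A Z" "finite Z'"
    have "Z' - {A} \<subseteq> Z" "finite (Z' - {A})" using Z' by auto
    with * have "\<not> null (p k) (g k ` (\<Inter>(Z' - {A}) \<inter> A))" by simp
    moreover have "g k ` (\<Inter>(Z' - {A}) \<inter> A) \<subseteq> g k ` \<Inter>Z'" by (intro image_mono) auto
    ultimately show "\<not> null (p k) (g k ` \<Inter>Z')" using null_mono by blast
  qed
qed

text \<open>
  Higher levels of the tower impose stronger conditions, so finitely many conditions from several
  levels can be compared at the highest one.
\<close>

lemma null_image_mono:
  assumes "k \<le> l" "null (p k) (g k ` S)"
  shows "null (p l) (g l ` S)"
  using assms
proof (induction l rule: dec_induct)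
  case (step l)
  then have "null (filtermap (\<pi> l) (p (Suc l))) (\<pi> l ` g (Suc l) ` S)"
    by (simp add: bond commute[of l] image_comp)
  then show ?case
    unfolding null_def eventually_filtermap by (rule eventually_mono) blast
qed

lemma compatible_decide:
  assumes "compatible Z"
  shows "compatible (insert A Z) \<or> compatible (insert (- A) Z)"
proof (rule ccontr)
  assume "\<not> ?thesis"
  then obtain k1 Z1 k2 Z2 where
    1: "Z1 \<subseteq> Z" "finite Z1" "null (p k1) (g k1 ` (\<Inter>Z1 \<inter> A))" and
    2: "Z2 \<subseteq> Z" "finite Z2" "null (p k2) (g k2 ` (\<Inter>Z2 \<inter> - A))"
    unfolding compatible_insert_iff by blast
  let ?k = "max k1 k2"
  have "null (p ?k) (g ?k ` (\<Inter>Z1 \<inter> A) \<union> g ?k ` (\<Inter>Z2 \<inter> - A))"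
    using null_image_mono[OF _ 1(3)] null_image_mono[OF _ 2(3)] by (simp add: null_Un_iff)
  then have "null (p ?k) (g ?k ` \<Inter>(Z1 \<union> Z2))" by (rule null_mono) blast
  then show False using compatibleD[OF assms, of "Z1 \<union> Z2" ?k] 1 2 by simp
qed

text \<open>
  If a member of the contour is not compatible with the family, its complement is.  Otherwise, there is
  a lift for each level \<open>k\<close> and each finite subfamily \<open>Z'\<close>, and a common cover \<open>L\<close> of these fewer than
  \<open>\<bb>\<close> lifts is compatible: what a lift loses by intersection with \<open>L\<close> lies in finitely many of
  its pieces, each of which has a null image.
\<close>

lemma compatible_avoid_contour:
  assumes Z: "compatible Z" "|Z| <o \<bb>" and \<bb>: "natLeq <o \<bb>"
    and free: "\<And>k. p k \<le> cofinite" and no: "\<And>k Y G. contour_on \<xi> Y G \<Longrightarrow> \<not> p k \<le> G"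
    and V: "contour_on \<xi> X F" "\<xi> \<noteq> 1"
  shows "\<exists>L. compatible (insert L Z) \<and> null F L"
proof (cases "\<exists>A. null F (- A) \<and> \<not> compatible (insert A Z)")
  case True
  then show ?thesis using compatible_decide[OF Z(1)] by blast
next
  case False
  then have pos: "compatible (insert A Z)" if "null F (- A)" for A using that by blast
  from V(1) show ?thesis
  proof cases
    case cofinite
    then show ?thesis using V(2) by simp
  next
    case (bind \<beta> Y G)
    let ?I = "(UNIV :: nat set) \<times> Fpow Z"
    have "\<forall>i\<in>?I. \<exists>K\<subseteq>\<Inter>(snd i) \<inter> (\<Union>n. Y n). (\<forall>n. null (G n) (K \<inter> Y n)) \<and>
        (\<forall>n. null (p (fst i)) (g (fst i) ` (K \<inter> Y n))) \<and> \<not> null (p (fst i)) (g (fst i) ` K)"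
    proof (intro ballI transversal_lift[OF ultra free _ bind(4,5,6)])
      fix i assume i: "i \<in> ?I"
      show "\<not> p (fst i) \<le> H" if "contour_on (LEAST \<alpha>. \<forall>n. \<beta> n < \<alpha>) W H" for W H
        using no that bind(1) by blast
      show "\<not> null (p (fst i)) (g (fst i) ` (\<Inter>(snd i) \<inter> A))"
        if "null (filter_bind sequentially G) (- A)" for A
        using pos that i unfolding bind(3) compatible_insert_iff by (auto simp: Fpow_def)
    qed
    from bchoice[OF this] obtain K where "\<forall>i\<in>?I. K i \<subseteq> \<Inter>(snd i) \<inter> (\<Union>n. Y n) \<and>
        (\<forall>n. null (G n) (K i \<inter> Y n)) \<and> (\<forall>n. null (p (fst i)) (g (fst i) ` (K i \<inter> Y n))) \<and>
        \<not> null (p (fst i)) (g (fst i) ` K i)" by (rule exE)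
    then have K: "K i \<subseteq> \<Inter>(snd i) \<inter> (\<Union>n. Y n)" "null (G n) (K i \<inter> Y n)"
      "null (p (fst i)) (g (fst i) ` (K i \<inter> Y n))" "\<not> null (p (fst i)) (g (fst i) ` K i)"
      if "i \<in> ?I" for i n
      using that by blast+
    have "|?I| <o \<bb>" using \<bb> Z(2) by (rule card_of_nat_times_Fpow_less)
    have "\<exists>L. null F L \<and> (\<forall>i\<in>?I. \<forall>\<^sub>F n in sequentially. K i \<inter> Y n \<subseteq> L)"
      unfolding bind(3) by (rule common_null_cover[OF bind(4,6) \<open>|?I| <o \<bb>\<close>]) (rule K(2))
    then obtain L where L: "null F L" "\<forall>i\<in>?I. \<forall>\<^sub>F n in sequentially. K i \<inter> Y n \<subseteq> L"
      by (elim exE conjE)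
    have "\<not> null (p k) (g k ` (\<Inter>Z' \<inter> L))" if "Z' \<subseteq> Z" "finite Z'" for k Z'
    proof
      assume null: "null (p k) (g k ` (\<Inter>Z' \<inter> L))"
      have i: "(k, Z') \<in> ?I" using that by (simp add: Fpow_def)
      obtain N where N: "\<And>n. n \<ge> N \<Longrightarrow> K (k, Z') \<inter> Y n \<subseteq> L"
        using bspec[OF L(2) i] by (auto simp: eventually_sequentially)
      have "null (p k) (\<Union>n\<in>{..<N}. g k ` (K (k, Z') \<inter> Y n))"
        using K(3)[OF i] by (intro null_UN_finite) simp_all
      with null have "null (p k) (g k ` (\<Inter>Z' \<inter> L) \<union> (\<Union>n\<in>{..<N}. g k ` (K (k, Z') \<inter> Y n)))"
        by (simp add: null_Un_iff)
      moreover have "K (k, Z') \<subseteq> (\<Inter>Z' \<inter> L) \<union> (\<Union>n\<in>{..<N}. K (k, Z') \<inter> Y n)"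
      proof
        fix x assume x: "x \<in> K (k, Z')"
        then have "x \<in> \<Inter>Z' \<inter> (\<Union>n. Y n)" using subsetD[OF K(1)[OF i]] by simp
        then obtain n where n: "x \<in> Y n" "x \<in> \<Inter>Z'" by blast
        show "x \<in> (\<Inter>Z' \<inter> L) \<union> (\<Union>n\<in>{..<N}. K (k, Z') \<inter> Y n)"
          using x n N[of n] by (cases "n < N") auto
      qed
      then have "g k ` K (k, Z') \<subseteq> g k ` (\<Inter>Z' \<inter> L) \<union> (\<Union>n\<in>{..<N}. g k ` (K (k, Z') \<inter> Y n))"
        by blast
      ultimately have "null (p k) (g k ` K (k, Z'))" by (rule null_mono)
      with K(4)[OF i] show False by simp
    qed
    with L(1) show ?thesis unfolding compatible_insert_iff by blast
  qed
qed

lemma compatible_insert_UNIV: "compatible Z \<Longrightarrow> compatible (insert UNIV Z)"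
  unfolding compatible_insert_iff by (simp add: compatible_def)

text \<open>
  Maximality decides every set, and intersections of finitely many members are nonempty because their
  images are not null.  Preimages of members of \<open>p k\<close> belong to \<open>U\<close> since their complements have null
  images.
\<close>

lemma ultrafilter_of_maximal_compatible:
  assumes U: "compatible U" "\<forall>A. compatible (insert A U) \<longrightarrow> A \<in> U"
  shows "\<exists>u. ultrafilter u \<and> (\<forall>P. eventually P u \<longleftrightarrow> {x. P x} \<in> U) \<and>
    (\<forall>k. filtermap (g k) u = p k)"
proof -
  have decide: "A \<in> U \<or> - A \<in> U" for A using compatible_decide[OF U(1)] U(2) by blast
  have meet: "\<Inter>Z' \<noteq> {}" if "Z' \<subseteq> U" "finite Z'" for Z'
    using compatibleD[OF U(1) that] by (auto simp: null_def)
  define u where "u = Abs_filter (\<lambda>P. {x. P x} \<in> U)"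
  have u: "eventually P u \<longleftrightarrow> {x. P x} \<in> U" for P
    unfolding u_def
  proof (rule eventually_Abs_filter, rule is_filter.intro)
    show "{x. True} \<in> U" using U compatible_insert_UNIV by simp
    show "{x. P x \<and> Q x} \<in> U" if "{x. P x} \<in> U" "{x. Q x} \<in> U" for P Q
    proof (rule ccontr)
      assume "\<not> ?thesis"
      then have "- {x. P x \<and> Q x} \<in> U" using decide by blast
      with that meet[of "{{x. P x}, {x. Q x}, - {x. P x \<and> Q x}}"] show False by auto
    qed
    show "{x. Q x} \<in> U" if "\<forall>x. P x \<longrightarrow> Q x" "{x. P x} \<in> U" for P Q
    proof (rule ccontr)
      assume "\<not> ?thesis"
      then have "- {x. Q x} \<in> U" using decide by blast
      with that meet[of "{{x. P x}, - {x. Q x}}"] show False by auto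
    qed
  qed
  have uu: "ultrafilter u"
    unfolding ultrafilter_def
  proof
    show "u \<noteq> bot" using u[of "\<lambda>_. False"] meet[of "{{}}"] by (auto simp: eventually_False[symmetric])
    show "\<forall>P. eventually P u \<or> (\<forall>\<^sub>F x in u. \<not> P x)"
      using decide by (auto simp: u Collect_neg_eq)
  qed
  have *: "eventually P (filtermap (g k) u)" if P: "eventually P (p k)" for P k
  proof (rule ccontr)
    assume "\<not> ?thesis"
    then have "{x. \<not> P (g k x)} \<in> U"
      using decide[of "{x. P (g k x)}"] by (simp add: eventually_filtermap u Collect_neg_eq)
    then have "\<not> null (p k) (g k ` {x. \<not> P (g k x)})"
      using compatibleD[OF U(1), of "{{x. \<not> P (g k x)}}" k] by simp
    moreover have "null (p k) {y. \<not> P y}" using P by (simp add: null_def)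
    then have "null (p k) (g k ` {x. \<not> P (g k x)})" by (rule null_mono) auto
    ultimately show False by (rule notE)
  qed
  have "filtermap (g k) u = p k" for k
  proof (rule antisym)
    show "filtermap (g k) u \<le> p k" by (rule filter_leI) (rule *)
    show "p k \<le> filtermap (g k) u"
    proof (rule filter_leI)
      fix P assume P: "eventually P (filtermap (g k) u)"
      show "eventually P (p k)"
      proof (rule ccontr)
        assume "\<not> eventually P (p k)"
        then have "eventually (\<lambda>x. \<not> P x) (p k)" using ultra[of k] by (auto simp: ultrafilter_def)
        then have "eventually (\<lambda>x. \<not> P x) (filtermap (g k) u)" by (rule *)
        with P have "eventually (\<lambda>_. False) (filtermap (g k) u)" by eventually_elim simp
        with uu show False
          by (simp add: ultrafilter_def eventually_False filtermap_bot_iff)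
      qed
    qed
  qed
  with uu u show ?thesis by (intro exI[of _ u] conjI allI)
qed

text \<open>
  Each set \<open>v\<close> of natural numbers is the index of one step, which adds a null set of \<open>E v\<close> if \<open>E v\<close> is
  a contour of rank \<open>\<xi>\<close>.
\<close>

lemma ultrafilter_above_tower_without_contour:
  fixes E :: "nat set \<Rightarrow> nat filter"
  assumes \<bb>: "\<bb> =o \<cc>"
    and free: "\<And>k. p k \<le> cofinite" and no: "\<And>k Y G. contour_on \<xi> Y G \<Longrightarrow> \<not> p k \<le> G"
    and E: "\<And>Y G. contour_on \<xi> Y G \<Longrightarrow> G \<in> range E" and "\<xi> \<noteq> 1"
  shows "\<exists>u. ultrafilter u \<and> (\<forall>k. filtermap (g k) u = p k) \<and>
    (\<forall>Y G. contour_on \<xi> Y G \<longrightarrow> \<not> u \<le> G)"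
proof -
  have "natLeq <o |UNIV :: nat set set|"
    using ordIso_ordLess_trans[OF ordIso_symmetric[OF card_of_nat] card_of_Pow] by simp
  then have nat_\<bb>: "natLeq <o \<bb>" using ordIso_symmetric[OF \<bb>] by (rule ordLess_ordIso_trans)
  have "\<exists>Z. compatible Z \<and> (\<forall>v. \<exists>L\<in>Z. (\<exists>Y. contour_on \<xi> Y (E v)) \<longrightarrow> null (E v) L)"
  proof (rule transfinite_extension[OF compatible_finite_character compatible_empty])
    fix Z and v :: "nat set"
    assume Z: "compatible Z" "|Z| <o |UNIV :: nat set set|"
    have "|Z| <o \<bb>" using Z(2) ordIso_symmetric[OF \<bb>] by (rule ordLess_ordIso_trans)
    note Z_less = this
    show "\<exists>L. compatible (insert L Z) \<and> ((\<exists>Y. contour_on \<xi> Y (E v)) \<longrightarrow> null (E v) L)"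
    proof (cases "\<exists>Y. contour_on \<xi> Y (E v)")
      case True
      then obtain Y where Y: "contour_on \<xi> Y (E v)" ..
      have "\<exists>L. compatible (insert L Z) \<and> null (E v) L"
        using compatible_avoid_contour[OF Z(1) Z_less nat_\<bb> free _ Y \<open>\<xi> \<noteq> 1\<close>] no by blast
      then show ?thesis by blast
    next
      case False
      then show ?thesis using compatible_insert_UNIV[OF Z(1)] by blast
    qed
  qed
  then obtain Z where Z: "compatible Z"
    "\<And>v Y. contour_on \<xi> Y (E v) \<Longrightarrow> \<exists>L\<in>Z. null (E v) L" by blast
  obtain U where U: "compatible U" "Z \<subseteq> U" "\<forall>A. compatible (insert A U) \<longrightarrow> A \<in> U"
    by (rule maximal_of_finite_character[OF compatible_finite_character Z(1)]) blast
  obtain u where u: "ultrafilter u" "\<forall>P. eventually P u \<longleftrightarrow> {x. P x} \<in> U"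
    "\<forall>k. filtermap (g k) u = p k"
    using ultrafilter_of_maximal_compatible[OF U(1,3)] by (elim exE conjE)
  have "\<not> u \<le> G" if G: "contour_on \<xi> Y G" for Y G
  proof
    assume le: "u \<le> G"
    obtain v where v: "G = E v" using E[OF G] by blast
    obtain L where L: "L \<in> U" "null G L" using Z(2)[OF G[unfolded v]] U(2) unfolding v by blast
    have "null u L" using le L(2) by (rule null_filter_leD)
    moreover have "null u (- L)" using L(1) by (simp add: null_def u(2))
    ultimately show False using not_null_ultrafilter[OF u(1)] by blast
  qed
  with u(1,3) show ?thesis by blast
qed

end

section \<open>Upper bounds of increasing sequences\<close>

theorem theorem2p21:
  fixes \<xi> :: ordinal and p :: "nat \<Rightarrow> nat filter"
  assumes "\<bb> =o \<cc>"
    and "1 < \<xi>" and "\<xi> \<le> \<omega>\<^sub>1"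
    and "\<And>n. p n \<in> \<P> \<xi>"
    and "\<And>n. p (Suc n) >RK p n"
  shows "\<exists>u\<in>\<P> \<xi>. \<forall>n. u >RK p n"
proof -
  have ultra: "ultrafilter (p n)" for n using assms(4)[of n] by (simp add: P_class_def)
  have below: "\<exists>X F. contour_on \<beta> X F \<and> p n \<le> F" if "1 \<le> \<beta>" "\<beta> < \<xi>" for \<beta> n
    using assms(4)[of n] that unfolding P_class_def monotone_sequential_contour_iff by blast
  have no: "\<not> p n \<le> F" if "contour_on \<xi> X F" for X F n
    using assms(4)[of n] that unfolding P_class_def monotone_sequential_contour_iff by blast
  have free: "p n \<le> cofinite" for n
    using below[of 1 n] assms(2) contour_on_le_cofinite by (meson order_refl order_trans)
  have "\<exists>f. surj f \<and> filtermap f (p (Suc n)) = p n" for n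
    using assms(5)[of n] rk_ge_surj[OF ultra[of "Suc n"]] unfolding rk_greater_def by metis
  then obtain \<pi> where \<pi>: "\<And>n. surj (\<pi> n)" "\<And>n. filtermap (\<pi> n) (p (Suc n)) = p n" by metis
  have "\<exists>g :: nat \<Rightarrow> nat \<Rightarrow> nat. \<forall>k. surj (g k) \<and> g k = \<pi> k \<circ> g (Suc k)"
    by (rule surjective_tower) (rule \<pi>(1))
  then obtain g :: "nat \<Rightarrow> nat \<Rightarrow> nat" where g: "surj (g k)" "g k = \<pi> k \<circ> g (Suc k)" for k
    by blast
  interpret ultrafilter_tower p g \<pi> by unfold_locales (fact ultra \<pi>(2) g)+
  obtain E :: "nat set \<Rightarrow> nat filter" where E: "\<And>\<beta> X F. contour_on \<beta> X F \<Longrightarrow> F \<in> range E"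
    by (rule contours_indexed_by_continuum) blast
  have "\<exists>u. ultrafilter u \<and> (\<forall>k. filtermap (g k) u = p k) \<and>
      (\<forall>X F. contour_on \<xi> X F \<longrightarrow> \<not> u \<le> F)"
    by (rule ultrafilter_above_tower_without_contour[OF assms(1) free])
      (erule no, erule E, use assms(2) in simp)
  then obtain u where u: "ultrafilter u" "filtermap (g k) u = p k"
    "contour_on \<xi> X F \<Longrightarrow> \<not> u \<le> F" for k X F by blast
  have above: "u \<ge>RK p n" for n using u(2) unfolding rk_ge_def by blast
  have "\<exists>F. monotone_sequential_contour \<beta> F \<and> u \<le> F" if \<beta>: "1 \<le> \<beta>" "\<beta> < \<xi>" for \<beta>
  proof -
    obtain X F where F: "contour_on \<beta> X F" "p 0 \<le> F" using below[OF \<beta>] by blast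
    obtain G where G: "contour_on \<beta> (g 0 -` X) G" "filtercomap (g 0) F \<le> G"
      using contour_on_pullback[OF F(1) g(1)] by blast
    have "u \<le> filtercomap (g 0) F" using F(2) by (simp flip: filtermap_le_iff_le_filtercomap add: u(2))
    then have "u \<le> G" using G(2) by (rule order_trans)
    then show ?thesis using G(1) monotone_sequential_contour_iff by blast
  qed
  then have "u \<in> \<P> \<xi>"
    using u(1,3) unfolding P_class_def monotone_sequential_contour_iff by blast
  moreover have "u >RK p n" for n
  proof -
    have "\<not> p n \<ge>RK u"
    proof
      assume "p n \<ge>RK u"
      then obtain f1 f2 where "filtermap f1 (p n) = u" "filtermap f2 u = p (Suc n)"
        using above[of "Suc n"] unfolding rk_ge_def by blast
      then have "filtermap (f2 \<circ> f1) (p n) = p (Suc n)" by (simp add: filtermap_compose)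
      then have "p n \<ge>RK p (Suc n)" unfolding rk_ge_def by blast
      with assms(5)[of n] show False by (simp add: rk_greater_def)
    qed
    with above show ?thesis by (simp add: rk_greater_def)
  qed
  ultimately show ?thesis by blast
qed

end
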